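(* Let $k \ge 2$ be an integer and let $G$ be a finite simple graph. Then $G$ has a $\{K_{1,1}, K_{1,2}, \ldots, K_{1,k}, \mathcal{T}(2k+1)\}$-factor if and only if \[ \mathit{iso}(G-S) \le \Big(k+\tfrac{1}{2}\Big)|S| \quad \text{for all } S \subseteq V(G). \]
   Context: For a graph $H$, $\mathit{iso}(H)$ denotes the number of isolated vertices of $H$. $K_{1,j}$ is the star with $j$ leaves. For a set $\mathcal{S}$ of connected graphs, an $\mathcal{S}$-factor of $G$ is a spanning subgraph $F$ of $G$ every component of which is isomorphic to an element of $\mathcal{S}$. For a tree $R$, $\mathit{Leaf}(R)$ denotes its set of leaves (degree-1 vertices). The family $\mathcal{T}(2k+1)$ ($k\ge 2$) is defined as follows. Consider trees $R$ such that for every vertex $v$ of $R-\mathit{Leaf}(R)$: (i) $\deg_{R-\mathit{Leaf}(R)}(v) \in \{1,3,\ldots,2k+1\}$, and (ii) $2\cdot(\text{number of leaves of } R \text{ adjacent to } v) + \deg_{R-\mathit{Leaf}(R)}(v) \le 2k+1$. For such $R$, form the tree $T_R$ from $R$ by (iii) inserting a new vertex of degree $2$ into each edge of $R-\mathit{Leaf}(R)$ (subdividing each such edge once; edges joining $R-\mathit{Leaf}(R)$ to leaves of $R$ are kept unchanged), and (iv) for each vertex $v$ of $R-\mathit{Leaf}(R)$ with $\deg_{R-\mathit{Leaf}(R)}(v) = 2r+1 < 2k+1$, attaching $k-r-(\text{number of leaves of } R \text{ adjacent to } v)$ new pendant edges together with their new endpoints to $v$. $\mathcal{T}(2k+1)$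 is the set of all trees $T_R$ so obtained from all trees $R$ satisfying (i) and (ii). *)

theory Defs
  imports Complex_Main "Graph_Theory.Graph_Theory"
begin

text \<open>
  Finite simple graphs are symmetric loop-free finite digraphs whose arcs are pairs (the locale
  \<^locale>\<open>pair_graph\<close>); an undirected edge is a pair of opposite arcs, so the degree of a vertex is
  its \<^const>\<open>out_degree\<close> and the connected components are the strongly connected ones,
  \<^const>\<open>pre_digraph.sccs\<close>.
\<close>

definition iso_count :: "('a, 'b) pre_digraph \<Rightarrow> nat" where
  "iso_count H = card {v \<in> verts H. out_degree H v = 0}"

definition is_factor ::
    "'b pair_pre_digraph set \<Rightarrow> 'a pair_pre_digraph \<Rightarrow> 'a pair_pre_digraph \<Rightarrow> bool" where
  "is_factor \<S> F G \<longleftrightarrow> pair_graph F \<and> spanning (with_proj F) (with_proj G) \<and>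
     (\<forall>C \<in> pre_digraph.sccs (with_proj F). \<exists>H \<in> \<S>. digraph_iso C (with_proj H))"

text \<open>
  The predicate \<^const>\<open>tree\<close> cannot be used for graphs in this representation: the walk
  \<open>u, v, u\<close> along an edge and back counts as a \<^const>\<open>pre_digraph.cycle\<close>. The cycles of the
  undirected graph are those of length at least 3.
\<close>
definition graph_tree :: "'a pair_pre_digraph \<Rightarrow> bool" where
  "graph_tree R \<longleftrightarrow> pair_graph R \<and> connected (with_proj R) \<and>
     \<not> (\<exists>p. pre_digraph.cycle (with_proj R) p \<and> 3 \<le> length p)"

definition Leaf :: "'a pair_pre_digraph \<Rightarrow> 'a set" where
  "Leaf R = {v \<in> pverts R. out_degree (with_proj R) v = 1}"

definition core :: "'a pair_pre_digraph \<Rightarrow> ('a, 'a \<times> 'a) pre_digraph" where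
  "core R = with_proj R \<restriction> (pverts R - Leaf R)"

definition leaf_count :: "'a pair_pre_digraph \<Rightarrow> 'a \<Rightarrow> nat" where
  "leaf_count R v = card {u \<in> Leaf R. (v, u) \<in> parcs R}"

definition admissible :: "nat \<Rightarrow> 'a pair_pre_digraph \<Rightarrow> bool" where
  "admissible k R \<longleftrightarrow> graph_tree R \<and>
     (\<forall>v \<in> verts (core R).
        out_degree (core R) v \<in> {2 * r + 1 | r. r \<le> k} \<and>
        2 * leaf_count R v + out_degree (core R) v \<le> 2 * k + 1)"

text \<open>
  Vertices of \<open>T\<^sub>R\<close>: those of \<open>R\<close>, one \<open>Mid {u, v}\<close> subdividing each edge \<open>uv\<close> of the core, and
  the endpoints \<open>New v i\<close> of the added pendant edges at \<open>v\<close>.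
\<close>
datatype 'a tvert = Old 'a | Mid "'a set" | New 'a nat

text \<open>
  The natural-number subtraction does not truncate on admissible \<open>R\<close>, where
  \<open>leaf_count R v \<le> k - r\<close> for \<open>v\<close> of core degree \<open>2 * r + 1\<close>.
\<close>
definition new_pendants :: "nat \<Rightarrow> 'a pair_pre_digraph \<Rightarrow> ('a \<times> nat) set" where
  "new_pendants k R = {(v, i). v \<in> verts (core R) \<and>
     (\<exists>r. out_degree (core R) v = 2 * r + 1 \<and> 2 * r + 1 < 2 * k + 1 \<and>
          i < k - r - leaf_count R v)}"

definition T_of :: "nat \<Rightarrow> 'a pair_pre_digraph \<Rightarrow> 'a tvert pair_pre_digraph" where
  "T_of k R =
    (let E = {(Old u, Old v) | u v. (u, v) \<in> parcs R \<and> (u \<in> Leaf R \<or> v \<in> Leaf R)}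
           \<union> {(Old u, Mid {u, v}) | u v. (u, v) \<in> arcs (core R)}
           \<union> {(Old v, New v i) | v i. (v, i) \<in> new_pendants k R}
     in \<lparr> pverts = Old ` pverts R
           \<union> {Mid {u, v} | u v. (u, v) \<in> arcs (core R)}
           \<union> {New v i | v i. (v, i) \<in> new_pendants k R},
          parcs = E \<union> E\<inverse> \<rparr>)"

text \<open>
  \<open>T_trees k\<close> is the family \<open>\<T>(2 k + 1)\<close>. Trees on natural numbers suffice because
  factor components are compared with its members only up to isomorphism.
\<close>
definition T_trees :: "nat \<Rightarrow> nat tvert pair_pre_digraph set" where
  "T_trees k = {T_of k R | R. admissible k R}"

definition stars :: "nat \<Rightarrow> 'a pair_pre_digraph set" where
  "stars k = {H. \<exists>j \<in> {1..k}. complete_bipartite_digraph 1 j (with_proj H)}"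

end

theory Submission
  imports Defs
begin

text \<open>
  Necessity: on every member of the family put weight \<open>1/2\<close> on the edges at the subdividing vertices
  and weight \<open>1\<close> on all others. The weights at each vertex then sum to a number in
  \<open>[1, k + 1/2]\<close>, and so they do in a factor. Counting the weight between \<open>S\<close> and the vertices
  isolated by its removal gives the inequality.

  Sufficiency: the inequality is Hall's condition for every vertex to send two half tokens to
  neighbours, such that no vertex receives more than \<open>2 k + 1\<close>. From such a distribution one gets a
  set \<open>A\<close> of centres such that only the vertices outside \<open>A\<close> send, only those in \<open>A\<close> receive, and
  each receives something. A vertex that splits its tokens between two centres is an edge of a
  multigraph on \<open>A\<close>. Take the number of these edges minimal. Then every end of such an edge
  receives exactly \<open>2 k + 1\<close> half tokens, since otherwise both tokens of the edge could go to one
  end, or the edge is a path with three vertices that can be turned into a star. There is no cycle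
  either, since its edges could all be directed around it. Hence the components without such an
  edge are stars, and the others are the trees \<open>T\<^sub>R\<close> where the core of \<open>R\<close> is a component of the
  multigraph and the leaves of \<open>R\<close> are the vertices sending both tokens to the same centre. As
  degree plus twice the number of leaves is already \<open>2 k + 1\<close>, no pendant edges are added.
\<close>

section \<open>Token distributions\<close>

lemma hall_marriage:
  fixes N :: "'i \<Rightarrow> 'b set"
  assumes "finite I" "\<And>i. i \<in> I \<Longrightarrow> finite (N i)"
    and "\<And>J. J \<subseteq> I \<Longrightarrow> card J \<le> card (\<Union>i\<in>J. N i)"
  shows "\<exists>f. inj_on f I \<and> (\<forall>i\<in>I. f i \<in> N i)"
  using assms
proof (induction "card I" arbitrary: I N rule: less_induct)
  case less
  note fin = less.prems(1) and finN = less.prems(2) and cond = less.prems(3)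
  show ?case
  proof (cases "I = {}")
    case False
    show ?thesis
    \<comment> \<open>The two cases of the Halmos-Vaughan induction: a tight \<open>J\<close> is
      matched into its own neighbourhood and the rest outside it; without one, every proper nonempty
      subfamily has a spare element, so an arbitrary choice for one index does no harm.\<close>
    proof (cases "\<exists>J. J \<noteq> {} \<and> J \<subset> I \<and> card J = card (\<Union>i\<in>J. N i)")
      case True
      then obtain J where J: "J \<noteq> {}" "J \<subset> I" "card J = card (\<Union>i\<in>J. N i)" by blast
      let ?NJ = "\<Union>i\<in>J. N i"
      have finJ: "finite J" using J fin finite_subset by blast
      have finNJ: "finite ?NJ" using J finJ finN by blast
      have "card J < card I" using J(2) fin by (rule psubset_card_mono[rotated])
      moreover have "\<And>i. i \<in> J \<Longrightarrow> finite (N i)" using J finN by blast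
      moreover have "\<And>K. K \<subseteq> J \<Longrightarrow> card K \<le> card (\<Union>i\<in>K. N i)" using J cond by blast
      ultimately obtain f1 where f1: "inj_on f1 J" "\<forall>i\<in>J. f1 i \<in> N i"
        using less.hyps finJ by metis
      have "card (I - J) < card I"
        using J fin by (intro psubset_card_mono) auto
      moreover have "finite (I - J)" using fin by blast
      moreover have "\<And>i. i \<in> I - J \<Longrightarrow> finite (N i - ?NJ)" using finN by blast
      \<comment> \<open>Hall's condition for \<open>J \<union> K\<close> survives the removal of
        \<open>?NJ\<close>, because \<open>J\<close> accounts for exactly \<open>card ?NJ\<close> of
        it.\<close>
      moreover have "card K \<le> card (\<Union>i\<in>K. N i - ?NJ)" if K: "K \<subseteq> I - J" for K
      proof -
        have finK: "finite K" using K fin finite_subset by blast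
        have "card K + card J = card (J \<union> K)"
          using K finK finJ by (subst card_Un_disjoint) auto
        also have "\<dots> \<le> card (\<Union>i\<in>J \<union> K. N i)" using K J by (intro cond) auto
        also have "(\<Union>i\<in>J \<union> K. N i) = ?NJ \<union> (\<Union>i\<in>K. N i - ?NJ)" by blast
        also have "card \<dots> \<le> card ?NJ + card (\<Union>i\<in>K. N i - ?NJ)" by (rule card_Un_le)
        finally show ?thesis using J by simp
      qed
      ultimately obtain f2 where f2: "inj_on f2 (I - J)" "\<forall>i\<in>I - J. f2 i \<in> N i - ?NJ"
        using less.hyps[of "I - J" "\<lambda>i. N i - ?NJ"] by auto
      define f where "f i = (if i \<in> J then f1 i else f2 i)" for i
      have "inj_on f I"
      proof (rule inj_onI)
        fix x y assume xy: "x \<in> I" "y \<in> I" "f x = f y"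
        show "x = y"
        proof (cases "x \<in> J"; cases "y \<in> J")
          assume "x \<in> J" "y \<in> J" then show ?thesis using xy f1 by (auto simp: f_def inj_on_def)
        next
          assume "x \<in> J" "y \<notin> J" then show ?thesis using xy f1 f2 by (auto simp: f_def)
        next
          assume "x \<notin> J" "y \<in> J" then show ?thesis using xy f1 f2 by (auto simp: f_def) (metis DiffI)
        next
          assume "x \<notin> J" "y \<notin> J" then show ?thesis using xy f2 by (auto simp: f_def inj_on_def)
        qed
      qed
      moreover have "\<forall>i\<in>I. f i \<in> N i" using f1 f2 by (auto simp: f_def)
      ultimately show ?thesis by blast
    next
      case no_tight: False
      obtain i where i: "i \<in> I" using False by blast
      have "card {i} \<le> card (\<Union>j\<in>{i}. N j)" using i by (intro cond) auto
      then have "N i \<noteq> {}" by auto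
      then obtain y where y: "y \<in> N i" by blast
      have "card (I - {i}) < card I" using i fin by (meson card_Diff1_less)
      moreover have "card K \<le> card (\<Union>j\<in>K. N j - {y})" if K: "K \<subseteq> I - {i}" for K
      proof (cases "K = {}")
        case False
        have "K \<subset> I" using K i by blast
        then have "card K < card (\<Union>j\<in>K. N j)"
          using no_tight False cond[of K] by (metis order_le_less psubset_imp_subset)
        moreover have "(\<Union>j\<in>K. N j - {y}) = (\<Union>j\<in>K. N j) - {y}" by blast
        ultimately show ?thesis by (simp add: card_Diff_singleton_if) linarith
      qed simp
      ultimately obtain f where f: "inj_on f (I - {i})" "\<forall>j\<in>I - {i}. f j \<in> N j - {y}"
        using less.hyps[of "I - {i}" "\<lambda>j. N j - {y}"] fin finN by auto
      have "inj_on (f(i := y)) I" using f by (auto simp: inj_on_def)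
      moreover have "\<forall>j\<in>I. (f(i := y)) j \<in> N j" using f y by auto
      ultimately show ?thesis by blast
    qed
  qed auto
qed

definition load :: "'a set \<Rightarrow> ('a \<Rightarrow> 'a) \<Rightarrow> ('a \<Rightarrow> 'a) \<Rightarrow> 'a \<Rightarrow> nat" where
  "load B g h a = (\<Sum>b\<in>B. of_bool (g b = a) + of_bool (h b = a))"

lemma load_pos:
  assumes "finite B" "b \<in> B" "g b = a \<or> h b = a"
  shows "1 \<le> load B g h a"
proof -
  have "1 \<le> (of_bool (g b = a) + of_bool (h b = a) :: nat)" using assms(3) by auto
  also have "\<dots> \<le> load B g h a"
    unfolding load_def using assms by (intro member_le_sum) auto
  finally show ?thesis .
qed

lemma load_mono: "finite B' \<Longrightarrow> B \<subseteq> B' \<Longrightarrow> load B g h a \<le> load B' g h a"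
  unfolding load_def by (rule sum_mono2) auto

lemma load_eq_card:
  "finite B \<Longrightarrow> load B g h a = card {b \<in> B. g b = a} + card {b \<in> B. h b = a}"
  by (simp only: load_def sum.distrib sum_of_bool_eq of_nat_id Collect_conj_eq Collect_mem_eq)

lemma load_same: "finite B \<Longrightarrow> load B g g a = 2 * card {b \<in> B. g b = a}"
  by (simp add: load_eq_card)

text \<open>Hall's theorem with two copies of each sender, the \<open>bool\<close> telling its
  tokens apart, and \<open>m\<close> slots at each receiver. Tokens at the same receiver occupy
  different slots, which bounds the load.\<close>

lemma two_token_hall:
  fixes N :: "'a \<Rightarrow> 'a set"
  assumes "finite V" "\<And>v. v \<in> V \<Longrightarrow> finite (N v)"
    and cond: "\<And>X. X \<subseteq> V \<Longrightarrow> 2 * card X \<le> m * card (\<Union>v\<in>X. N v)"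
  shows "\<exists>g h. (\<forall>v\<in>V. g v \<in> N v \<and> h v \<in> N v) \<and> (\<forall>u. load V g h u \<le> m)"
proof -
  define I where "I = V \<times> (UNIV :: bool set)"
  define M where "M i = N (fst i) \<times> {..<m}" for i :: "'a \<times> bool"
  have "card J \<le> card (\<Union>i\<in>J. M i)" if J: "J \<subseteq> I" for J
  proof -
    have fJ: "finite (fst ` J)" using finite_subset[OF J] assms(1) by (simp add: I_def)
    have "J \<subseteq> fst ` J \<times> UNIV" by force
    then have "card J \<le> card (fst ` J \<times> (UNIV :: bool set))" using fJ by (intro card_mono) auto
    also have "\<dots> = 2 * card (fst ` J)" by (simp add: card_cartesian_product)
    also have "\<dots> \<le> m * card (\<Union>v\<in>fst ` J. N v)" using J by (intro cond) (auto simp: I_def)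
    also have "\<dots> = card ((\<Union>v\<in>fst ` J. N v) \<times> {..<m})" by (simp add: card_cartesian_product)
    also have "(\<Union>v\<in>fst ` J. N v) \<times> {..<m} = (\<Union>i\<in>J. M i)" by (auto simp: M_def)
    finally show ?thesis .
  qed
  then obtain f where f: "inj_on f I" "\<forall>i\<in>I. f i \<in> M i"
    using hall_marriage[of I M] assms by (auto simp: I_def M_def)
  define g where "g v = fst (f (v, False))" for v
  define h where "h v = fst (f (v, True))" for v
  have "load V g h u \<le> m" for u
  proof -
    have "load V g h u = card {v \<in> V. g v = u} + card {v \<in> V. h v = u}"
      using assms(1) by (rule load_eq_card)
    also have "\<dots> = card ({v \<in> V. g v = u} \<times> {False} \<union> {v \<in> V. h v = u} \<times> {True})"
      using assms(1) by (subst card_Un_disjoint) (auto simp: card_cartesian_product)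
    also have "\<dots> \<le> card {..<m}"
    proof (rule card_inj_on_le[where f = "snd \<circ> f"])
      show "inj_on (snd \<circ> f) ({v \<in> V. g v = u} \<times> {False} \<union> {v \<in> V. h v = u} \<times> {True})"
      proof (rule inj_onI)
        fix x y
        assume x: "x \<in> {v \<in> V. g v = u} \<times> {False} \<union> {v \<in> V. h v = u} \<times> {True}"
          and y: "y \<in> {v \<in> V. g v = u} \<times> {False} \<union> {v \<in> V. h v = u} \<times> {True}"
          and eq: "(snd \<circ> f) x = (snd \<circ> f) y"
        have "fst (f x) = u" "fst (f y) = u" using x y by (auto simp: g_def h_def)
        then have "f x = f y" using eq by (simp add: prod_eq_iff)
        then show "x = y" using f(1) x y by (auto simp: I_def inj_on_def)
      qed
      show "(snd \<circ> f) ` ({v \<in> V. g v = u} \<times> {False} \<union> {v \<in> V. h v = u} \<times> {True}) \<subseteq> {..<m}"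
        using f(2) unfolding I_def M_def by (auto simp: mem_Times_iff)
    qed simp
    finally show ?thesis by simp
  qed
  moreover have "\<forall>v\<in>V. g v \<in> N v \<and> h v \<in> N v" using f(2) by (auto simp: I_def M_def g_def h_def mem_Times_iff)
  ultimately show ?thesis by blast
qed

section \<open>From token distributions to allotments\<close>

text \<open>
  Backward analysis as in a game on the relation \<open>R\<close>: \<open>A\<close>, \<open>P\<close> and \<open>M\<close> are the won, lost and
  drawn positions, the moves being the reversed arcs.
\<close>
lemma peeling:
  assumes "finite V"
  obtains A P M where "V = A \<union> P \<union> M" "A \<inter> P = {}" "(A \<union> P) \<inter> M = {}"
    "\<And>a. a \<in> A \<Longrightarrow> \<exists>p\<in>P. R p a"
    "\<And>p u. p \<in> P \<Longrightarrow> u \<in> V \<Longrightarrow> R p u \<Longrightarrow> u \<in> A"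
    "\<And>m. m \<in> M \<Longrightarrow> \<exists>m'\<in>M. R m' m"
proof -
  \<comment> \<open>\<open>P A\<close> holds the positions that are lost once those in
    \<open>A\<close> are won; \<open>Q A\<close> says that every position in \<open>A\<close> can
    indeed move into \<open>P A\<close>. The remaining closure property comes from taking
    \<open>A\<close> of greatest cardinality.\<close>
  define P where "P A = {v \<in> V - A. \<forall>u\<in>V. R u v \<longrightarrow> u \<in> A}" for A
  define Q where "Q A \<longleftrightarrow> A \<subseteq> V \<and> (\<forall>a\<in>A. \<exists>p\<in>P A. R p a)" for A
  have "Q {}" by (simp add: Q_def)
  moreover have "\<forall>A. Q A \<longrightarrow> card A < Suc (card V)"
    using assms by (auto simp: Q_def less_Suc_eq_le card_mono)
  ultimately obtain A where A: "Q A" "\<And>A'. Q A' \<Longrightarrow> card A' \<le> card A"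
    using ex_has_greatest_nat[of Q "{}" card] by blast
  have finA: "finite A" using A(1) assms finite_subset by (auto simp: Q_def)
  have succ: "u \<in> A" if "p \<in> P A" "u \<in> V" "R p u" for p u
  proof (rule ccontr)
    assume "u \<notin> A"
    \<comment> \<open>Since the predecessor \<open>p\<close> of \<open>u\<close> lies outside
      \<open>A\<close>, adding \<open>u\<close> to \<open>A\<close> does not shrink the lost set, so
      \<open>Q\<close> is preserved and \<open>A\<close> was not maximal.\<close>
    have "u \<notin> P A" using that by (auto simp: P_def)
    then have sub: "P A \<subseteq> P (insert u A)" by (auto simp: P_def)
    have "Q (insert u A)" using A(1) that sub unfolding Q_def by blast
    then show False using A(2) \<open>u \<notin> A\<close> finA by fastforce
  qed
  show thesis
  proof (rule that[of A "P A" "V - A - P A"])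
    show "V = A \<union> P A \<union> (V - A - P A)" using A(1) by (auto simp: Q_def P_def)
    \<comment> \<open>Not being lost, \<open>m\<close> has a predecessor outside \<open>A\<close>;
      were that predecessor lost, \<open>m\<close> would be in \<open>A\<close> by
      \<open>succ\<close>.\<close>
    show "\<exists>m'\<in>V - A - P A. R m' m" if "m \<in> V - A - P A" for m
      using that succ[of _ m] unfolding P_def by blast
    show "A \<inter> P A = {}" "(A \<union> P A) \<inter> (V - A - P A) = {}" by (auto simp: P_def)
    show "\<exists>p\<in>P A. R p a" if "a \<in> A" for a using A(1) that by (simp add: Q_def)
  qed (rule succ)
qed

text \<open>
  The vertices outside \<open>A\<close> send one half token along \<open>g\<close> and one along \<open>h\<close>; for \<open>g b = h b\<close> the
  vertex \<open>b\<close> counts twice in the load of \<open>g b\<close>.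
\<close>
definition allotment ::
    "nat \<Rightarrow> ('a \<Rightarrow> 'a \<Rightarrow> bool) \<Rightarrow> 'a set \<Rightarrow> 'a set \<Rightarrow> ('a \<Rightarrow> 'a) \<Rightarrow> ('a \<Rightarrow> 'a) \<Rightarrow> bool" where
  "allotment k E V A g h \<longleftrightarrow> A \<subseteq> V \<and>
     (\<forall>b\<in>V - A. g b \<in> A \<and> h b \<in> A \<and> E b (g b) \<and> E b (h b)) \<and>
     (\<forall>a\<in>A. 1 \<le> load (V - A) g h a \<and> load (V - A) g h a \<le> 2 * k + 1)"

text \<open>The senders of each part send within that part, so neither part adds to the loads of the
  other. This glues an allotment on the won and lost vertices to one found separately on the drawn
  vertices.\<close>

lemma allotment_Un:
  assumes "allotment k E V A g h" "allotment k E W B g' h'" "V \<inter> W = {}" "finite V" "finite W"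
  shows "allotment k E (V \<union> W) (A \<union> B)
    (\<lambda>x. if x \<in> V then g x else g' x) (\<lambda>x. if x \<in> V then h x else h' x)"
    (is "allotment k E _ _ ?g ?h")
proof -
  have AB: "A \<subseteq> V" "B \<subseteq> W" using assms by (auto simp: allotment_def)
  have eq: "V \<union> W - (A \<union> B) = (V - A) \<union> (W - B)" using AB assms(3) by auto
  have split: "load (V \<union> W - (A \<union> B)) ?g ?h a = load (V - A) g h a + load (W - B) g' h' a" for a
  proof -
    have "load (V \<union> W - (A \<union> B)) ?g ?h a = load (V - A) ?g ?h a + load (W - B) ?g ?h a"
      unfolding eq load_def using assms by (intro sum.union_disjoint) auto
    moreover have "load (V - A) ?g ?h a = load (V - A) g h a"
      unfolding load_def by (intro sum.cong) auto
    moreover have "load (W - B) ?g ?h a = load (W - B) g' h' a"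
      unfolding load_def using assms(3) by (intro sum.cong) auto
    ultimately show ?thesis by simp
  qed
  have "load (W - B) g' h' a = 0" if "a \<in> A" for a
    using that assms(2,3,5) AB by (auto simp: load_def allotment_def)
  moreover have "load (V - A) g h a = 0" if "a \<in> B" for a
    using that assms(1,3,4) AB by (auto simp: load_def allotment_def)
  ultimately show ?thesis
    using assms(1-3) unfolding allotment_def split by (auto simp: Diff_eq)
qed

text \<open>A finite graph without isolated vertices has a spanning star forest. Among the partial
  forests, given by leaves \<open>L\<close> and a centre map \<open>h\<close>, one that covers the
  most vertices is taken; an uncovered vertex could always be added after a local change.\<close>

lemma star_cover:
  fixes Adj :: "'a \<Rightarrow> 'a \<Rightarrow> bool"
  assumes "finite M" and sym: "\<And>x y. Adj x y \<Longrightarrow> Adj y x"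
    and ex: "\<And>x. x \<in> M \<Longrightarrow> \<exists>y\<in>M. y \<noteq> x \<and> Adj x y"
  shows "\<exists>C h. C \<subseteq> M \<and> (\<forall>l\<in>M - C. h l \<in> C \<and> Adj l (h l)) \<and> C \<subseteq> h ` (M - C)"
proof -
  define Q where "Q s \<longleftrightarrow> fst s \<subseteq> M \<and> (\<forall>l\<in>fst s. snd s l \<in> M - fst s \<and> Adj l (snd s l))"
    for s :: "'a set \<times> ('a \<Rightarrow> 'a)"
  define cov where "cov s = fst s \<union> snd s ` fst s" for s :: "'a set \<times> ('a \<Rightarrow> 'a)"
  have cov_sub: "cov s \<subseteq> M" if "Q s" for s using that by (auto simp: Q_def cov_def)
  have "Q ({}, id)" by (simp add: Q_def)
  moreover have "\<forall>s. Q s \<longrightarrow> card (cov s) < Suc (card M)"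
    using assms(1) cov_sub by (auto simp: less_Suc_eq_le card_mono)
  ultimately obtain s where s: "Q s" "\<And>t. Q t \<Longrightarrow> card (cov t) \<le> card (cov s)"
    using ex_has_greatest_nat[of Q "({}, id)" "card \<circ> cov" "Suc (card M)"] by (metis comp_apply)
  obtain L h where Lh: "s = (L, h)" by (cases s)
  have L: "L \<subseteq> M" "\<And>l. l \<in> L \<Longrightarrow> h l \<in> M \<and> h l \<notin> L \<and> Adj l (h l)"
    using s(1) by (auto simp: Q_def Lh)
  have max: False if "Q t" "cov s \<subset> cov t" for t
    using s(2)[OF that(1)] psubset_card_mono[OF _ that(2)] cov_sub[OF that(1)] assms(1)
    by (meson finite_subset not_le)
  have "cov s = M"
  proof (rule ccontr)
    assume "cov s \<noteq> M"
    then obtain v where v: "v \<in> M" "v \<notin> L" "v \<notin> h ` L"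
      using cov_sub[OF s(1)] by (auto simp: cov_def Lh)
    obtain u where u: "u \<in> M" "u \<noteq> v" "Adj v u" using ex[OF v(1)] by blast
    show False
    proof (cases "u \<in> L")
      \<comment> \<open>\<open>u\<close> is uncovered or a centre, so \<open>v\<close> can become a
        leaf of \<open>u\<close>.\<close>
      case False
      show False
      proof (rule max)
        show "Q (insert v L, h(v := u))" using u v L False by (auto simp: Q_def)
        show "cov s \<subset> cov (insert v L, h(v := u))" using v by (auto simp: cov_def Lh)
      qed
    next
      case True
      define c where "c = h u"
      have c: "c \<in> M" "c \<notin> L" "Adj c u" "c \<noteq> v" using L(2)[OF True] v True by (auto simp: c_def sym)
      show False
      proof (cases "\<exists>l\<in>L. l \<noteq> u \<and> h l = c")
        \<comment> \<open>The star at \<open>c\<close> keeps another leaf, so \<open>u\<close> can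
          leave it and become a centre with the leaf \<open>v\<close>.\<close>
        case other: True
        show False
        proof (rule max)
          show "Q (insert v (L - {u}), h(v := u))"
            using u v L True by (auto simp: Q_def)
          have "c \<in> h ` (L - {u})" using other by blast
          then have "h ` (L - {u}) = h ` L"
            using True unfolding c_def by (metis image_insert insert_Diff insert_absorb)
          moreover have "(h(v := u)) ` insert v (L - {u}) = insert u (h ` (L - {u}))"
            using v by (auto simp: image_iff)
          ultimately show "cov s \<subset> cov (insert v (L - {u}), h(v := u))"
            using v True by (auto simp: cov_def Lh)
        qed
      next
        \<comment> \<open>The edge from \<open>c\<close> to \<open>u\<close> is a star by itself;
          turned around, it has the centre \<open>u\<close> and the leaves \<open>c\<close> and
          \<open>v\<close>.\<close>
        case alone: False
        show False
        proof (rule max)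
          show "Q (insert c (insert v (L - {u})), h(c := u, v := u))"
            using u v L c True alone by (auto simp: Q_def)
          show "cov s \<subset> cov (insert c (insert v (L - {u})), h(c := u, v := u))"
            using v True alone c by (auto simp: cov_def Lh c_def)
        qed
      qed
    qed
  qed
  then have "M - L = h ` L" using L by (auto simp: cov_def Lh)
  then show ?thesis using L by (intro exI[of _ "M - L"] exI[of _ h]) (auto simp: Diff_Diff_Int Int_absorb1)
qed

text \<open>In the application \<open>p m\<close> is a vertex that sent a token to \<open>m\<close>,
  and now \<open>m\<close> sends both of its tokens back. At most two vertices do so at the same
  receiver, so loads stay at most 4, which is below \<open>2 * k + 1\<close> because
  \<open>2 \<le> k\<close>.\<close>

lemma allotment_of_predecessor_map:
  assumes fin: "finite M" and sym: "\<And>x y. E x y \<Longrightarrow> E y x" and irr: "\<And>x. \<not> E x x" and "2 \<le> k"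
    and p: "\<And>m. m \<in> M \<Longrightarrow> p m \<in> M \<and> E m (p m)"
    and two: "\<And>x. card {m \<in> M. p m = x} \<le> 2"
  shows "\<exists>A g h. allotment k E M A g h"
proof -
  obtain A P Z where AP: "M = A \<union> P \<union> Z" "A \<inter> P = {}" "(A \<union> P) \<inter> Z = {}"
    and A: "\<And>a. a \<in> A \<Longrightarrow> \<exists>b\<in>P. p b = a"
    and P: "\<And>b u. b \<in> P \<Longrightarrow> u \<in> M \<Longrightarrow> p b = u \<Longrightarrow> u \<in> A"
    and Z: "\<And>z. z \<in> Z \<Longrightarrow> \<exists>y\<in>Z. p y = z"
    by (rule peeling[OF fin, of "\<lambda>u v. p u = v"]) (rule that)
  have fins: "finite A" "finite P" "finite Z" using fin AP by auto
  have AP_diff: "A \<union> P - A = P" using AP by auto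
  have "allotment k E (A \<union> P) A p p"
    unfolding allotment_def AP_diff
  proof (intro conjI ballI)
    fix a assume a: "a \<in> A"
    obtain b where "b \<in> P" "p b = a" using A[OF a] by blast
    then show "1 \<le> load P p p a" using fins by (intro load_pos) auto
    have "card {m \<in> P. p m = a} \<le> card {m \<in> M. p m = a}" using fin AP by (intro card_mono) auto
    then show "load P p p a \<le> 2 * k + 1" using two[of a] \<open>2 \<le> k\<close> fins by (simp add: load_same)
  qed (use p P AP in auto)
  moreover obtain C g where "allotment k E Z C g g"
  proof -
    \<comment> \<open>On the drawn vertices \<open>p\<close> is onto, hence a permutation, and it
      has no fixed points. As a graph its cycles have degree at most 2, so each star of a star cover
      has at most two leaves.\<close>
    have "Z \<subseteq> p ` Z" using Z by blast
    then have pZ: "p ` Z = Z" using fins card_seteq[of "p ` Z" Z] card_image_le[of Z p] by auto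
    then have inj: "inj_on p Z" using fins by (simp add: eq_card_imp_inj_on)
    define Adj where "Adj x y \<longleftrightarrow> p x = y \<or> p y = x" for x y
    have neq: "p z \<noteq> z" if "z \<in> Z" for z using p[of z] irr[of z] that AP by auto
    have "\<exists>y\<in>Z. y \<noteq> x \<and> Adj x y" if "x \<in> Z" for x
      using neq[OF that] pZ that by (auto simp: Adj_def)
    then obtain C h where C: "C \<subseteq> Z" "\<forall>l\<in>Z - C. h l \<in> C \<and> Adj l (h l)" "C \<subseteq> h ` (Z - C)"
      using star_cover[of Z Adj] fins unfolding Adj_def by blast
    have "allotment k E Z C h h"
      unfolding allotment_def
    proof (intro conjI ballI)
      show "C \<subseteq> Z" by (rule C)
      fix b assume b: "b \<in> Z - C"
      have "h b \<in> Z" "Adj b (h b)" using C b by auto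
      then have "E b (h b)" using p[of b] p[of "h b"] b AP sym by (auto simp: Adj_def)
      then show "h b \<in> C" "h b \<in> C" "E b (h b)" "E b (h b)" using C b by auto
    next
      fix c assume c: "c \<in> C"
      then obtain l where "l \<in> Z - C" "h l = c" using C by auto
      then show "1 \<le> load (Z - C) h h c" using fins by (intro load_pos) auto
      have cZ: "c \<in> Z" using c C by auto
      have "{l \<in> Z - C. h l = c} \<subseteq> {p c} \<union> {l \<in> Z. p l = c}"
        using C by (auto simp: Adj_def)
      then have "card {l \<in> Z - C. h l = c} \<le> card ({p c} \<union> {l \<in> Z. p l = c})"
        using fins by (intro card_mono) auto
      also have "\<dots> \<le> card {p c} + card {l \<in> Z. p l = c}" by (rule card_Un_le)
      also have "card {l \<in> Z. p l = c} \<le> 1"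
        using inj fins by (auto simp: card_le_Suc0_iff_eq inj_on_def)
      finally show "load (Z - C) h h c \<le> 2 * k + 1" using fins \<open>2 \<le> k\<close> by (simp add: load_same)
    qed
    then show thesis by (rule that)
  qed
  ultimately show ?thesis using allotment_Un[of k E "A \<union> P" A p p Z C g g] AP fins by auto
qed

text \<open>In the two-token distribution a vertex may both send and receive. Peeling along the
  relation of sending settles the won and lost vertices; each drawn vertex has a drawn giver
  \<open>p m\<close>, and a giver serves at most two vertices because it has two tokens.\<close>

lemma allotment_exists:
  assumes fin: "finite V" and sym: "\<And>x y. E x y \<Longrightarrow> E y x" and irr: "\<And>x. \<not> E x x" and "2 \<le> k"
    and cond: "\<And>X. X \<subseteq> V \<Longrightarrow> 2 * card X \<le> (2 * k + 1) * card (\<Union>v\<in>X. {u \<in> V. E v u})"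
  shows "\<exists>A g h. allotment k E V A g h"
proof -
  obtain g h where gh: "\<And>v. v \<in> V \<Longrightarrow> g v \<in> V \<and> E v (g v) \<and> h v \<in> V \<and> E v (h v)"
      "\<And>u. load V g h u \<le> 2 * k + 1"
    using two_token_hall[OF fin _ cond] fin by auto
  obtain A P M where AP: "V = A \<union> P \<union> M" "A \<inter> P = {}" "(A \<union> P) \<inter> M = {}"
    and A: "\<And>a. a \<in> A \<Longrightarrow> \<exists>b\<in>P. g b = a \<or> h b = a"
    and P: "\<And>b u. b \<in> P \<Longrightarrow> u \<in> V \<Longrightarrow> g b = u \<or> h b = u \<Longrightarrow> u \<in> A"
    and M: "\<And>m. m \<in> M \<Longrightarrow> \<exists>m'\<in>M. g m' = m \<or> h m' = m"
    by (rule peeling[OF fin, of "\<lambda>u v. g u = v \<or> h u = v"]) (rule that)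
  have fins: "finite A" "finite P" "finite M" using fin AP by auto
  have AP_diff: "A \<union> P - A = P" using AP by auto
  have "allotment k E (A \<union> P) A g h"
    unfolding allotment_def AP_diff
  proof (intro conjI ballI)
    fix a assume a: "a \<in> A"
    obtain b where "b \<in> P" "g b = a \<or> h b = a" using A[OF a] by blast
    then show "1 \<le> load P g h a" by (rule load_pos[OF fins(2)])
    have "load P g h a \<le> load V g h a" using fin AP by (intro load_mono) auto
    then show "load P g h a \<le> 2 * k + 1" using gh(2)[of a] by simp
  qed (use gh P AP in auto)
  moreover obtain C g' h' where "allotment k E M C g' h'"
  proof -
    obtain p where p: "\<And>m. m \<in> M \<Longrightarrow> p m \<in> M \<and> (g (p m) = m \<or> h (p m) = m)"
      using M by metis
    have "card {m \<in> M. p m = x} \<le> 2" for x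
    proof -
      have "{m \<in> M. p m = x} \<subseteq> {g x, h x}" using p by fastforce
      then have "card {m \<in> M. p m = x} \<le> card {g x, h x}" by (intro card_mono) auto
      also have "\<dots> \<le> 2" by (simp add: card_insert_if)
      finally show ?thesis .
    qed
    moreover have "p m \<in> M \<and> E m (p m)" if "m \<in> M" for m
      using p[OF that] gh(1)[of "p m"] sym AP by auto
    ultimately show thesis
      using allotment_of_predecessor_map[of M E k p] fins sym irr \<open>2 \<le> k\<close> that by blast
  qed
  ultimately show ?thesis using allotment_Un[of k E "A \<union> P" A g h M C g' h'] AP fins by auto
qed

section \<open>Redirecting tokens and minimising the number of split vertices\<close>

text \<open>Sending both tokens of \<open>b\<close> to \<open>t b\<close> takes one away from the
  other end \<open>o' b\<close>. The balance has sums on both sides to avoid subtraction of natural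
  numbers.\<close>

lemma load_redirect:
  assumes "finite B" "S \<subseteq> B" "\<And>b. b \<in> S \<Longrightarrow> {t b, o' b} = {g b, h b} \<and> g b \<noteq> h b"
  shows "load B (\<lambda>b. if b \<in> S then t b else g b) (\<lambda>b. if b \<in> S then t b else h b) a
      + card {b \<in> S. o' b = a} = load B g h a + card {b \<in> S. t b = a}"
proof -
  have card_eq: "card {b \<in> S. q b = a} = (\<Sum>b\<in>B. if b \<in> S then of_bool (q b = a) else 0)" for q
  proof -
    have "card {b \<in> S. q b = a} = (\<Sum>b\<in>S. of_bool (q b = a))"
      using finite_subset[OF assms(2,1)] by (simp only: sum_of_bool_eq of_nat_id Collect_conj_eq Collect_mem_eq)
    also have "\<dots> = (\<Sum>b\<in>B. if b \<in> S then of_bool (q b = a) else 0)"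
      using assms by (simp add: sum.If_cases Int_absorb1 Collect_mem_eq)
    finally show ?thesis .
  qed
  have *: "of_bool (t b = a) + of_bool (o' b = a) = (of_bool (g b = a) + of_bool (h b = a) :: nat)"
    if "b \<in> S" for b
  proof -
    have "t b = g b \<and> o' b = h b \<or> t b = h b \<and> o' b = g b"
      using assms(3)[OF that] by (simp add: doubleton_eq_iff)
    then show ?thesis by (elim disjE) simp_all
  qed
  show ?thesis
    unfolding card_eq load_def sum.distrib[symmetric]
    by (intro sum.cong) (use * in auto)
qed

text \<open>
  The last assumption expresses acyclicity of the multigraph: for the edges \<open>S\<close> of a directed cycle,
  the maps \<open>s\<close> and \<open>t\<close> to the start and the end of an edge would contradict it.
\<close>
locale tight_allotment =
  fixes k :: nat and E :: "'a \<Rightarrow> 'a \<Rightarrow> bool" and V A :: "'a set" and g h :: "'a \<Rightarrow> 'a"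
  assumes finite_V: "finite V"
    and allotment: "allotment k E V A g h"
    and full: "b \<in> V - A \<Longrightarrow> g b \<noteq> h b \<Longrightarrow> a \<in> {g b, h b} \<Longrightarrow> load (V - A) g h a = 2 * k + 1"
    and no_rotation: "S \<subseteq> {b \<in> V - A. g b \<noteq> h b} \<Longrightarrow> \<forall>b\<in>S. {s b, t b} = {g b, h b} \<Longrightarrow>
      inj_on s S \<Longrightarrow> inj_on t S \<Longrightarrow> s ` S = t ` S \<Longrightarrow> S = {}"

lemma allotment_redirect:
  assumes "finite V" "allotment k E V A g h" "S \<subseteq> {b \<in> V - A. g b \<noteq> h b}"
    and st: "\<And>b. b \<in> S \<Longrightarrow> {t b, s b} = {g b, h b}"
    and load_ok: "\<And>a. a \<in> A \<Longrightarrow> card {b \<in> S. s b = a} + 1 \<le> load (V - A) g h a + card {b \<in> S. t b = a}"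
      "\<And>a. a \<in> A \<Longrightarrow>
        load (V - A) g h a + card {b \<in> S. t b = a} \<le> 2 * k + 1 + card {b \<in> S. s b = a}"
  shows "allotment k E V A (\<lambda>b. if b \<in> S then t b else g b) (\<lambda>b. if b \<in> S then t b else h b)"
proof -
  have eq: "load (V - A) (\<lambda>b. if b \<in> S then t b else g b) (\<lambda>b. if b \<in> S then t b else h b) a
      + card {b \<in> S. s b = a} = load (V - A) g h a + card {b \<in> S. t b = a}" for a
    using assms(1,3) st by (intro load_redirect) auto
  have "1 \<le> load (V - A) (\<lambda>b. if b \<in> S then t b else g b) (\<lambda>b. if b \<in> S then t b else h b) a
    \<and> load (V - A) (\<lambda>b. if b \<in> S then t b else g b) (\<lambda>b. if b \<in> S then t b else h b) a \<le> 2 * k + 1"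
    if "a \<in> A" for a
    using load_ok[OF that] eq[of a] by linarith
  moreover have "t b \<in> A \<and> E b (t b)" if "b \<in> S" for b
  proof -
    have "t b = g b \<or> t b = h b" using st[OF that] by blast
    then show ?thesis using assms(2,3) that by (auto simp: allotment_def)
  qed
  ultimately show ?thesis using assms(2) by (auto simp: allotment_def)
qed

text \<open>Both ends receive only the token of \<open>b\<close>, so the path through
  \<open>b\<close> is detached from the rest. With \<open>b\<close> as its centre the load there is
  4, within the bound since \<open>2 \<le> k\<close>, and no new split vertex arises.\<close>

lemma allotment_flip:
  assumes "finite V" "allotment k E V A g h" "\<And>x y. E x y \<Longrightarrow> E y x" "2 \<le> k"
    and b: "b \<in> V - A" "g b \<noteq> h b" and one: "load (V - A) g h (g b) = 1" "load (V - A) g h (h b) = 1"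
  shows "allotment k E V (insert b (A - {g b, h b}))
    (\<lambda>c. if c \<in> {g b, h b} then b else g c) (\<lambda>c. if c \<in> {g b, h b} then b else h c)"
    (is "allotment k E V ?A ?g ?h")
proof -
  have gh: "g c \<in> A" "h c \<in> A" "E c (g c)" "E c (h c)" if "c \<in> V - A" for c
    using assms(2) that by (auto simp: allotment_def)
  have AV: "A \<subseteq> V" using assms(2) by (simp add: allotment_def)
  define B where "B = V - A - {b}"
  have finB: "finite B" "b \<notin> B" "V - A = insert b B" using b assms(1) by (auto simp: B_def)
  have B': "V - ?A = {g b, h b} \<union> B" "{g b, h b} \<inter> B = {}"
    using b gh[OF b(1)] AV by (auto simp: B_def)
  have load_B: "load (V - A) g h a = of_bool (g b = a) + of_bool (h b = a) + load B g h a" for a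
    using finB by (simp add: load_def)
  have "load B g h (g b) = 0" "load B g h (h b) = 0"
    using one b(2) by (simp_all add: load_B)
  then have other: "g c \<noteq> g b" "h c \<noteq> g b" "g c \<noteq> h b" "h c \<noteq> h b" if "c \<in> B" for c
    using that finB by (auto simp: load_def)
  have load': "load (V - ?A) ?g ?h a = (if a = b then 4 else 0) + load B g h a" for a
  proof -
    have "load (V - ?A) ?g ?h a = load {g b, h b} ?g ?h a + load B ?g ?h a"
      unfolding load_def B'(1) using finB B'(2) by (intro sum.union_disjoint) auto
    moreover have "load B ?g ?h a = load B g h a"
      unfolding load_def using B'(2) by (intro sum.cong) auto
    moreover have "load {g b, h b} ?g ?h a = (if a = b then 4 else 0)"
      using b(2) by (auto simp: load_def)
    ultimately show ?thesis by simp
  qed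
  have "load B g h b = 0"
    unfolding load_def
  proof (intro sum.neutral ballI)
    fix c assume "c \<in> B"
    then have "g c \<noteq> b" "h c \<noteq> b" using gh[of c] b finB by auto
    then show "of_bool (g c = b) + of_bool (h c = b) = (0 :: nat)" by simp
  qed
  moreover have "load (V - A) g h a = load B g h a" if "a \<in> A - {g b, h b}" for a
    using that by (auto simp: load_B)
  moreover have "g b \<in> A" "h b \<in> A" "b \<notin> A" using b gh by auto
  ultimately have "1 \<le> load (V - ?A) ?g ?h a \<and> load (V - ?A) ?g ?h a \<le> 2 * k + 1" if "a \<in> ?A" for a
    using that assms(2,4) unfolding load' by (auto simp: allotment_def)
  moreover have "?g c \<in> ?A \<and> ?h c \<in> ?A \<and> E c (?g c) \<and> E c (?h c)" if "c \<in> V - ?A" for c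
  proof (cases "c \<in> {g b, h b}")
    case True
    then show ?thesis using gh[OF b(1)] assms(3) by auto
  next
    case False
    then have "c \<in> B" using that B' by auto
    then show ?thesis using other[of c] gh[of c] False finB by auto
  qed
  ultimately show ?thesis using AV b unfolding allotment_def by blast
qed

text \<open>An allotment with the fewest split vertices is tight: a violation of fullness or of
  acyclicity would permit a redirection or a flip that removes a split vertex.\<close>

lemma tight_allotment_exists:
  assumes fin: "finite V" and sym: "\<And>x y. E x y \<Longrightarrow> E y x" and k: "2 \<le> k"
    and ex: "\<exists>A g h. allotment k E V A g h"
  shows "\<exists>A g h. tight_allotment k E V A g h"
proof -
  define N where "N A g h = {b \<in> V - A. g b \<noteq> h b}" for A and g h :: "'a \<Rightarrow> 'a"
  have finN: "finite (N A g h)" for A g h using fin by (simp add: N_def)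
  obtain A g h where all: "allotment k E V A g h"
    and min: "\<And>A' g' h'. allotment k E V A' g' h' \<Longrightarrow> card (N A g h) \<le> card (N A' g' h')"
  proof -
    define f where "f = (\<lambda>(A, g, h). card (N A g h))"
    obtain x where "(\<lambda>(A, g, h). allotment k E V A g h) x"
      "\<And>y. (\<lambda>(A, g, h). allotment k E V A g h) y \<Longrightarrow> f x \<le> f y"
      using ex ex_has_least_nat[of "\<lambda>(A, g, h). allotment k E V A g h" _ f] by fastforce
    then show thesis by (cases x) (auto simp: f_def intro: that)
  qed
  have better: False if "allotment k E V A' g' h'" "N A' g' h' \<subset> N A g h" for A' g' h'
    using min[OF that(1)] psubset_card_mono[OF finN that(2)] by simp
  have AB: "g b \<in> A" "h b \<in> A" if "b \<in> V - A" for b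
    using all that by (auto simp: allotment_def)
  have bounds: "1 \<le> load (V - A) g h a" "load (V - A) g h a \<le> 2 * k + 1" if "a \<in> A" for a
    using all that by (auto simp: allotment_def)
  have redirect: "S = {}"
    if S: "S \<subseteq> N A g h" and st: "\<And>b. b \<in> S \<Longrightarrow> {t b, s b} = {g b, h b}"
      and ok: "\<And>a. a \<in> A \<Longrightarrow> card {b \<in> S. s b = a} + 1 \<le> load (V - A) g h a + card {b \<in> S. t b = a}"
      "\<And>a. a \<in> A \<Longrightarrow>
        load (V - A) g h a + card {b \<in> S. t b = a} \<le> 2 * k + 1 + card {b \<in> S. s b = a}" for S s t
  proof (rule ccontr)
    assume "S \<noteq> {}"
    show False
    proof (rule better)
      show "allotment k E V A (\<lambda>b. if b \<in> S then t b else g b) (\<lambda>b. if b \<in> S then t b else h b)"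
        by (rule allotment_redirect[OF fin all _ st ok]) (use S in \<open>auto simp: N_def\<close>)
      show "N A (\<lambda>b. if b \<in> S then t b else g b) (\<lambda>b. if b \<in> S then t b else h b) \<subset> N A g h"
        using S \<open>S \<noteq> {}\<close> by (auto simp: N_def)
    qed
  qed
  \<comment> \<open>Moving the token of \<open>b\<close> from \<open>x\<close> to \<open>y\<close>
    must be impossible, so \<open>y\<close> is full or \<open>x\<close> receives nothing but this
    token.\<close>
  have shift: "load (V - A) g h y = 2 * k + 1 \<or> load (V - A) g h x = 1"
    if b: "b \<in> N A g h" and xy: "{x, y} = {g b, h b}" for b x y
  proof (rule ccontr)
    assume neg: "\<not> ?thesis"
    have A: "x \<in> A" "y \<in> A" and "x \<noteq> y" using AB[of b] b xy by (auto simp: N_def doubleton_eq_iff)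
    have singleton: "card {c \<in> {b}. z = a} = (if a = z then 1 else 0)" for z a
      by (auto simp: Collect_conv_if)
    have "{b} = {}"
    proof (rule redirect[where s = "\<lambda>_. x" and t = "\<lambda>_. y"])
      fix a assume "a \<in> A"
      then show "card {c \<in> {b}. x = a} + 1 \<le> load (V - A) g h a + card {c \<in> {b}. y = a}"
        "load (V - A) g h a + card {c \<in> {b}. y = a} \<le> 2 * k + 1 + card {c \<in> {b}. x = a}"
        unfolding singleton using neg bounds[of a] \<open>x \<noteq> y\<close> by (cases "a = x"; cases "a = y"; simp)+
    qed (use b xy in \<open>auto simp: insert_commute\<close>)
    then show False by simp
  qed
  have "tight_allotment k E V A g h"
  proof
    show "finite V" "allotment k E V A g h" by fact+
    fix b a assume b: "b \<in> V - A" "g b \<noteq> h b" and a: "a \<in> {g b, h b}"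
    have bN: "b \<in> N A g h" using b by (simp add: N_def)
    have or: "load (V - A) g h (g b) = 2 * k + 1 \<or> load (V - A) g h (h b) = 1"
      "load (V - A) g h (h b) = 2 * k + 1 \<or> load (V - A) g h (g b) = 1"
      using shift[OF bN, of "h b" "g b"] shift[OF bN, of "g b" "h b"] by auto
    show "load (V - A) g h a = 2 * k + 1"
    proof (rule ccontr)
      assume "load (V - A) g h a \<noteq> 2 * k + 1"
      \<comment> \<open>If one end is not full, the other has load 1 and is not full either, as
        \<open>2 * k + 1\<close> exceeds 1; so both loads are 1.\<close>
      then have one: "load (V - A) g h (g b) = 1" "load (V - A) g h (h b) = 1"
        using or a k by auto
      show False
        by (rule better[OF allotment_flip[OF fin all sym k b one]])
          (use b AB[OF b(1)] in \<open>auto simp: N_def\<close>)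
    qed
  next
    fix S s t
    assume S: "S \<subseteq> {b \<in> V - A. g b \<noteq> h b}" and st: "\<forall>b\<in>S. {s b, t b} = {g b, h b}"
      and inj: "inj_on s S" "inj_on t S" and im: "s ` S = t ` S"
    have finS: "finite S" using S fin finite_subset by fastforce
    have card_fib: "card {b \<in> S. q b = a} = of_bool (a \<in> q ` S)" if "inj_on q S" for q a
    proof (cases "a \<in> q ` S")
      case True
      then obtain c where "c \<in> S" "q c = a" by auto
      then have "{b \<in> S. q b = a} = {c}" using that by (auto simp: inj_on_def)
      then show ?thesis using True by simp
    qed (auto intro: card_eq_0_iff[THEN iffD2])
    \<comment> \<open>Every vertex on the cycle loses one token and gains one, so the loads do not
      change when each edge sends both tokens to its \<open>t\<close> end.\<close>
    show "S = {}"
      by (rule redirect[of S t s]) (use S st bounds im in \<open>auto simp: N_def card_fib inj insert_commute\<close>)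
  qed
  then show ?thesis by blast
qed

section \<open>Necessity\<close>

definition half_weighting :: "nat \<Rightarrow> 'a set \<Rightarrow> ('a \<times> 'a) set \<Rightarrow> ('a \<Rightarrow> 'a \<Rightarrow> real) \<Rightarrow> bool" where
  "half_weighting k V E w \<longleftrightarrow> (\<forall>(u, v)\<in>E. 0 \<le> w u v \<and> w u v = w v u) \<and>
     (\<forall>v\<in>V. 1 \<le> sum (w v) (E `` {v}) \<and> sum (w v) (E `` {v}) \<le> real k + 1 / 2)"

text \<open>Double counting: all weight at \<open>I\<close>, at least 1 per vertex, runs to
  \<open>S\<close>, and no vertex of \<open>S\<close> carries more than
  \<open>k + 1 / 2\<close>.\<close>

lemma isolated_le_of_half_weighting:
  assumes "finite V" "E \<subseteq> V \<times> V" "sym E" and w: "half_weighting k V E w" and "S \<subseteq> V"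
    and I: "I \<subseteq> V" "\<And>v. v \<in> I \<Longrightarrow> E `` {v} \<subseteq> S"
  shows "real (card I) \<le> (real k + 1 / 2) * real (card S)"
proof -
  have fin: "finite I" "finite S" "finite (E `` {v})" for v
    using assms(1,2,5) I(1) finite_subset by (auto intro: finite_subset[of "E `` {v}" V])
  have w_nonneg: "0 \<le> w u v" "w u v = w v u" if "(u, v) \<in> E" for u v
    using w that by (auto simp: half_weighting_def)
  have "real (card I) \<le> (\<Sum>v\<in>I. sum (w v) (E `` {v}))"
    using sum_mono[of I "\<lambda>_. 1" "\<lambda>v. sum (w v) (E `` {v})"] w I(1)
    by (force simp: half_weighting_def)
  also have "\<dots> = (\<Sum>v\<in>I. \<Sum>u\<in>S. if (v, u) \<in> E then w v u else 0)"
  proof (rule sum.cong[OF refl])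
    fix v assume "v \<in> I"
    then have "S \<inter> {u. (v, u) \<in> E} = E `` {v}" using I by auto
    then show "sum (w v) (E `` {v}) = (\<Sum>u\<in>S. if (v, u) \<in> E then w v u else 0)"
      using fin by (simp add: sum.If_cases)
  qed
  also have "\<dots> = (\<Sum>u\<in>S. \<Sum>v\<in>I. if (v, u) \<in> E then w v u else 0)" by (rule sum.swap)
  also have "\<dots> = (\<Sum>u\<in>S. sum (w u) (I \<inter> E `` {u}))"
  proof (rule sum.cong[OF refl])
    fix u
    have "{v. (v, u) \<in> E} = E `` {u}" using \<open>sym E\<close> by (auto dest: symD)
    then have "(\<Sum>v\<in>I. if (v, u) \<in> E then w v u else 0) = (\<Sum>v\<in>I \<inter> E `` {u}. w v u)"
      using fin by (simp add: sum.If_cases)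
    also have "\<dots> = sum (w u) (I \<inter> E `` {u})"
      using w_nonneg(2) by (intro sum.cong) auto
    finally show "(\<Sum>v\<in>I. if (v, u) \<in> E then w v u else 0) = sum (w u) (I \<inter> E `` {u})" .
  qed
  also have "\<dots> \<le> (\<Sum>u\<in>S. sum (w u) (E `` {u}))"
    using fin w_nonneg by (intro sum_mono sum_mono2) auto
  also have "\<dots> \<le> (\<Sum>u\<in>S. real k + 1 / 2)"
    using w \<open>S \<subseteq> V\<close> by (intro sum_mono) (auto simp: half_weighting_def)
  finally show ?thesis by (simp add: mult.commute)
qed

lemma half_weighting_iso:
  assumes "inj_on f V" "E \<subseteq> V \<times> V" "half_weighting k (f ` V) (map_prod f f ` E) w"
  shows "half_weighting k V E (\<lambda>u v. w (f u) (f v))"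
proof -
  have im: "(map_prod f f ` E) `` {f v} = f ` (E `` {v})" if "v \<in> V" for v
  proof (intro equalityI subsetI)
    fix x assume "x \<in> (map_prod f f ` E) `` {f v}"
    then obtain a b where ab: "(a, b) \<in> E" "f a = f v" "x = f b" by auto
    then have "a = v" using assms(1,2) that by (meson SigmaD1 inj_onD subsetD)
    then show "x \<in> f ` (E `` {v})" using ab by auto
  qed auto
  have "sum (w (f v)) ((map_prod f f ` E) `` {f v}) = (\<Sum>u\<in>E `` {v}. w (f v) (f u))" if "v \<in> V" for v
  proof -
    have "inj_on f (E `` {v})" using assms(1,2) by (auto intro: inj_on_subset)
    then show ?thesis unfolding im[OF that] by (simp add: sum.reindex)
  qed
  moreover have "0 \<le> w (f u) (f v) \<and> w (f u) (f v) = w (f v) (f u)" if "(u, v) \<in> E" for u v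
    using assms(3) that unfolding half_weighting_def by (auto simp: map_prod_def)
  ultimately show ?thesis using assms(3) by (auto simp: half_weighting_def)
qed

section \<open>Isomorphisms and the weights on members of the family\<close>

text \<open>A witness of \<open>digraph_iso\<close> carries separate maps for arcs, tails and heads.
  For arcs that are pairs, all of them are determined by the vertex map, so only an injection
  \<open>f\<close> remains.\<close>

lemma digraph_iso_pair_iff:
  assumes "wf_digraph C" "tail C = fst" "head C = snd"
  shows "digraph_iso C (with_proj H) \<longleftrightarrow>
    (\<exists>f. inj_on f (verts C) \<and> pverts H = f ` verts C \<and> parcs H = map_prod f f ` arcs C)"
proof
  assume "digraph_iso C (with_proj H)"
  then obtain F where F: "pre_digraph.digraph_isomorphism C F" "with_proj H = app_iso F C"
    by (auto simp: digraph_iso_def)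
  have t: "iso_tail F = fst" "iso_head F = snd"
    using arg_cong[OF F(2), of tail] arg_cong[OF F(2), of head] by simp_all
  have "iso_arcs F e = map_prod (iso_verts F) (iso_verts F) e" if "e \<in> arcs C" for e
    using F(1) that assms t by (auto simp: pre_digraph.digraph_isomorphism_def prod_eq_iff)
  then have "parcs H = map_prod (iso_verts F) (iso_verts F) ` arcs C"
    using arg_cong[OF F(2), of arcs] by auto
  moreover have "pverts H = iso_verts F ` verts C" using arg_cong[OF F(2), of verts] by simp
  ultimately show "\<exists>f. inj_on f (verts C) \<and> pverts H = f ` verts C \<and> parcs H = map_prod f f ` arcs C"
    using F(1) by (auto simp: pre_digraph.digraph_isomorphism_def)
next
  assume "\<exists>f. inj_on f (verts C) \<and> pverts H = f ` verts C \<and> parcs H = map_prod f f ` arcs C"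
  then obtain f where f: "inj_on f (verts C)" "pverts H = f ` verts C" "parcs H = map_prod f f ` arcs C"
    by blast
  interpret wf_digraph C by fact
  let ?F = "\<lparr>iso_verts = f, iso_arcs = map_prod f f, iso_head = snd, iso_tail = fst\<rparr>"
  have "arcs C \<subseteq> verts C \<times> verts C" using wellformed assms by fastforce
  then have "inj_on (map_prod f f) (arcs C)" using map_prod_inj_on[OF f(1) f(1)] inj_on_subset by blast
  then have "digraph_isomorphism ?F"
    using assms f by (auto simp: digraph_isomorphism_def)
  moreover have "with_proj H = app_iso ?F C" using f by (simp add: app_iso_def with_proj_def)
  ultimately show "digraph_iso C (with_proj H)" by (auto simp: digraph_iso_def)
qed

lemma out_degree_pair: "tail H = fst \<Longrightarrow> out_degree H v = card (arcs H `` {v})"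
proof -
  assume "tail H = fst"
  then have "out_arcs H v = Pair v ` (arcs H `` {v})" by (auto simp: out_arcs_def)
  then show ?thesis by (simp add: out_degree_def card_image inj_on_def)
qed

lemma half_weighting_star:
  assumes "complete_bipartite_digraph 1 j (with_proj H)" "1 \<le> j" "j \<le> k"
  shows "half_weighting k (pverts H) (parcs H) (\<lambda>_ _. 1)"
proof -
  obtain U L where UL: "pverts H = U \<union> L" "U \<inter> L = {}" "card U = 1" "card L = j"
      "parcs H = U \<times> L \<union> L \<times> U"
    using assms(1) by (auto simp: complete_bipartite_digraph_pair_def)
  have "card (parcs H `` {v}) = (if v \<in> U then j else 1)" if "v \<in> pverts H" for v
  proof -
    have "parcs H `` {v} = (if v \<in> U then L else U)" using UL that by auto
    then show ?thesis using UL by simp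
  qed
  then show ?thesis using assms(2,3) by (auto simp: half_weighting_def)
qed

lemma core_simps:
  "verts (core R) = pverts R - Leaf R"
  "arcs (core R) = {(u, v) \<in> parcs R. u \<in> pverts R - Leaf R \<and> v \<in> pverts R - Leaf R}"
  "tail (core R) = fst" "head (core R) = snd"
  by (auto simp: core_def)

lemma T_of_simps:
  "pverts (T_of k R) = Old ` pverts R \<union> {Mid {u, v} | u v. (u, v) \<in> arcs (core R)}
      \<union> {New v i | v i. (v, i) \<in> new_pendants k R}"
  "parcs (T_of k R) =
      {(Old u, Old v) | u v. (u, v) \<in> parcs R \<and> (u \<in> Leaf R \<or> v \<in> Leaf R)}
    \<union> {(Old v, Old u) | u v. (u, v) \<in> parcs R \<and> (u \<in> Leaf R \<or> v \<in> Leaf R)}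
    \<union> {(Old u, Mid {u, v}) | u v. (u, v) \<in> arcs (core R)}
    \<union> {(Mid {u, v}, Old u) | u v. (u, v) \<in> arcs (core R)}
    \<union> {(Old v, New v i) | v i. (v, i) \<in> new_pendants k R}
    \<union> {(New v i, Old v) | v i. (v, i) \<in> new_pendants k R}"
proof -
  have converse: "{(f x y, g x y) | x y. P x y}\<inverse> = {(g x y, f x y) | x y. P x y}"
    for f g :: "'c \<Rightarrow> 'd \<Rightarrow> 'a tvert" and P
    by blast
  show "pverts (T_of k R) = Old ` pverts R \<union> {Mid {u, v} | u v. (u, v) \<in> arcs (core R)}
      \<union> {New v i | v i. (v, i) \<in> new_pendants k R}"
    by (simp add: T_of_def Let_def)
  show "parcs (T_of k R) =
      {(Old u, Old v) | u v. (u, v) \<in> parcs R \<and> (u \<in> Leaf R \<or> v \<in> Leaf R)}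
    \<union> {(Old v, Old u) | u v. (u, v) \<in> parcs R \<and> (u \<in> Leaf R \<or> v \<in> Leaf R)}
    \<union> {(Old u, Mid {u, v}) | u v. (u, v) \<in> arcs (core R)}
    \<union> {(Mid {u, v}, Old u) | u v. (u, v) \<in> arcs (core R)}
    \<union> {(Old v, New v i) | v i. (v, i) \<in> new_pendants k R}
    \<union> {(New v i, Old v) | v i. (v, i) \<in> new_pendants k R}"
    unfolding T_of_def Let_def pair_pre_digraph.simps converse_Un converse by (simp only: Un_ac)
qed

text \<open>At a core vertex of core degree \<open>2 * r + 1\<close> with \<open>l\<close> leaves
  the sum is \<open>l + (r + 1 / 2) + (k - r - l)\<close>, so the new pendant edges fill it up to
  exactly \<open>k + 1 / 2\<close>. Every other vertex has sum 1: a midpoint has two half edges, the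
  rest one edge of weight 1.\<close>

lemma half_weighting_T_of:
  assumes "admissible k R" "2 \<le> k"
  shows "half_weighting k (pverts (T_of k R)) (parcs (T_of k R))
    (\<lambda>x y. case (x, y) of (Mid _, _) \<Rightarrow> 1 / 2 | (_, Mid _) \<Rightarrow> 1 / 2 | _ \<Rightarrow> 1)" (is "half_weighting _ _ ?E ?w")
proof -
  interpret R: pair_graph R using assms(1) by (simp add: admissible_def graph_tree_def)
  have sum_leaf: "sum (?w (Old v)) (?E `` {Old v}) = 1" if "v \<in> Leaf R" for v
  proof -
    have "?E `` {Old v} = Old ` (parcs R `` {v})"
      using that R.arcs_symmetric by (auto simp: T_of_simps core_simps new_pendants_def)
    moreover have "card (parcs R `` {v}) = 1" using that by (simp add: Leaf_def out_degree_pair)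
    ultimately show ?thesis by (simp add: sum.reindex inj_on_def)
  qed
  have sum_core: "sum (?w (Old v)) (?E `` {Old v}) = real k + 1 / 2"
    if v: "v \<in> pverts R" "v \<notin> Leaf R" for v
  proof -
    let ?L = "{u \<in> Leaf R. (v, u) \<in> parcs R}"
      and ?D = "arcs (core R) `` {v}" and ?N = "{i. (v, i) \<in> new_pendants k R}"
    have nb: "?E `` {Old v} = Old ` ?L \<union> (\<lambda>u. Mid {v, u}) ` ?D \<union> New v ` ?N"
      using v R.arcs_symmetric R.in_arcsD1 unfolding T_of_simps core_simps by (auto 0 3)
    have deg: "out_degree (core R) v = card ?D" by (simp add: out_degree_pair core_simps)
    have "v \<in> verts (core R)" using v by (simp add: core_simps)
    then have "card ?D \<in> {2 * r + 1 | r. r \<le> k}" "2 * leaf_count R v + card ?D \<le> 2 * k + 1"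
      using assms(1) unfolding admissible_def deg[symmetric] by blast+
    then obtain r where r: "card ?D = 2 * r + 1" "r \<le> k" "2 * leaf_count R v + card ?D \<le> 2 * k + 1"
      by blast
    have "i \<in> ?N \<longleftrightarrow> r < k \<and> i < k - r - leaf_count R v" for i
      using \<open>v \<in> verts (core R)\<close> by (simp add: new_pendants_def deg r(1))
    \<comment> \<open>For \<open>r = k\<close> the definition grants no pendants, and
      \<open>k - r - leaf_count R v\<close> is 0 as well, so one interval covers both cases.\<close>
    then have N: "?N = {..<k - r - leaf_count R v}" by auto
    have finD: "finite ?D" using r(1) card_ge_0_finite by force
    have finL: "finite ?L" by (rule finite_subset[OF _ R.pair_finite_verts]) (auto dest: R.in_arcsD2)
    have irr: "u \<noteq> v" if "u \<in> ?D" for u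
      using that R.no_loops' by (auto simp: core_simps)
    have "sum (?w (Old v)) (?E `` {Old v}) =
        sum (?w (Old v)) (Old ` ?L) + sum (?w (Old v)) ((\<lambda>u. Mid {v, u}) ` ?D) +
        sum (?w (Old v)) (New v ` ?N)"
      unfolding nb using finD finL N by (subst sum.union_disjoint, simp, simp, force)+ simp
    also have "sum (?w (Old v)) (Old ` ?L) = leaf_count R v"
      by (simp add: sum.reindex inj_on_def leaf_count_def)
    also have "sum (?w (Old v)) ((\<lambda>u. Mid {v, u}) ` ?D) = card ?D / 2"
      using irr by (subst sum.reindex) (auto simp: inj_on_def doubleton_eq_iff)
    also have "sum (?w (Old v)) (New v ` ?N) = real (k - r - leaf_count R v)"
      unfolding N by (simp add: sum.reindex inj_on_def)
    finally show ?thesis using r by (simp add: of_nat_diff field_simps)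
  qed
  have sum_mid: "sum (?w (Mid {u, v})) (?E `` {Mid {u, v}}) = 1" if uv: "(u, v) \<in> arcs (core R)" for u v
  proof -
    have vu: "(v, u) \<in> arcs (core R)" using uv R.arcs_symmetric by (auto simp: core_simps)
    \<comment> \<open>\<open>Mid {u, v}\<close> and \<open>Mid {v, u}\<close> coincide, so the two
      arcs of a core edge supply both neighbours of its midpoint.\<close>
    have "(Mid {u, v}, Old u) \<in> ?E" "(Mid {v, u}, Old v) \<in> ?E"
      unfolding T_of_simps(2) using uv vu by blast+
    then have "{Old u, Old v} \<subseteq> ?E `` {Mid {u, v}}" by (auto simp: insert_commute)
    moreover have "?E `` {Mid {u, v}} \<subseteq> {Old u, Old v}"
      by (auto simp: T_of_simps(2) doubleton_eq_iff)
    ultimately have "?E `` {Mid {u, v}} = {Old u, Old v}" by (rule equalityI[rotated])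
    moreover have "u \<noteq> v" using uv R.no_loops' by (auto simp: core_simps)
    ultimately show ?thesis by simp
  qed
  have sum_new: "sum (?w (New v i)) (?E `` {New v i}) = 1" if vi: "(v, i) \<in> new_pendants k R" for v i
  proof -
    have "?E `` {New v i} = {Old v}" using vi by (auto simp: T_of_simps(2))
    then show ?thesis by simp
  qed
  have "1 \<le> sum (?w x) (?E `` {x}) \<and> sum (?w x) (?E `` {x}) \<le> real k + 1 / 2"
    if "x \<in> pverts (T_of k R)" for x
    using that unfolding T_of_simps(1)
  proof (elim UnE)
    assume "x \<in> Old ` pverts R"
    then obtain v where "v \<in> pverts R" "x = Old v" by blast
    then show ?thesis using sum_leaf[of v] sum_core[of v] assms(2) by (cases "v \<in> Leaf R") simp_all
  next
    assume "x \<in> {Mid {u, v} | u v. (u, v) \<in> arcs (core R)}"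
    then obtain u v where "(u, v) \<in> arcs (core R)" "x = Mid {u, v}" by blast
    then show ?thesis using sum_mid[of u v] assms(2) by simp
  next
    assume "x \<in> {New v i | v i. (v, i) \<in> new_pendants k R}"
    then obtain v i where "(v, i) \<in> new_pendants k R" "x = New v i" by blast
    then show ?thesis using sum_new[of v i] assms(2) by simp
  qed
  moreover have "0 \<le> ?w x y \<and> ?w x y = ?w y x" for x y :: "'a tvert"
    by (cases x; cases y) simp_all
  ultimately show ?thesis by (simp add: half_weighting_def)
qed

section \<open>Gluing the weights over the components of a factor\<close>

text \<open>In a symmetric graph every arc can be walked back, so a strong component is closed under
  adjacency and is determined by its vertices.\<close>

lemma (in pair_graph) component_facts:
  assumes "C \<in> sccs"
  shows "C = with_proj G \<restriction> verts C" "verts C \<subseteq> pverts G" "strongly_connected C"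
    "\<And>u v. (u, v) \<in> parcs G \<Longrightarrow> u \<in> verts C \<Longrightarrow> v \<in> verts C"
proof -
  have ind: "induced_subgraph C (with_proj G)" using assms by (rule in_sccs_imp_induced)
  then show "C = with_proj G \<restriction> verts C"
    by (auto simp: induced_subgraph_def induce_subgraph_def subgraph_def compatible_def
        intro!: pre_digraph.equality)
  show "verts C \<subseteq> pverts G" using ind by (auto simp: induced_subgraph_def subgraph_def)
  show "strongly_connected C" using assms by (auto simp: sccs_def)
  fix u v assume uv: "(u, v) \<in> parcs G" "u \<in> verts C"
  have "verts C \<in> sccs_verts" using assms by (intro in_sccs_vertsI_sccs) simp
  moreover have "u \<rightarrow>\<^sup>*\<^bsub>with_proj G\<^esub> v" "v \<rightarrow>\<^sup>*\<^bsub>with_proj G\<^esub> u"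
    using uv arcs_symmetric[of u v] by (auto intro: reachable_adjI)
  ultimately show "v \<in> verts C" using uv by (auto simp: in_sccs_verts_conv_reachable)
qed


lemma half_weighting_member:
  assumes "H \<in> stars k \<union> T_trees k" "2 \<le> k"
  shows "\<exists>w. half_weighting k (pverts H) (parcs H) w"
proof (cases "H \<in> stars k")
  case True
  then obtain j where "j \<in> {1..k}" "complete_bipartite_digraph 1 j (with_proj H)"
    unfolding stars_def by blast
  then show ?thesis using half_weighting_star by fastforce
next
  case False
  then obtain R where "H = T_of k R" "admissible k R" using assms(1) unfolding T_trees_def by blast
  then show ?thesis using half_weighting_T_of \<open>2 \<le> k\<close> by blast
qed

text \<open>No arc joins two components, so weights chosen on each of them, selected at
  \<open>u\<close> by its component \<open>c u\<close>, fit together.\<close>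

lemma (in pair_graph) half_weighting_of_components:
  assumes "\<And>C. C \<in> sccs \<Longrightarrow> \<exists>w. half_weighting k (verts C) (arcs C) w"
  shows "\<exists>w. half_weighting k (pverts G) (parcs G) w"
proof -
  obtain W where W: "\<And>C. C \<in> sccs \<Longrightarrow> half_weighting k (verts C) (arcs C) (W C)"
    using assms by metis
  obtain c where c: "\<And>u. u \<in> pverts G \<Longrightarrow> c u \<in> sccs \<and> u \<in> verts (c u)"
    using scc_for_vert_ex by metis
  have arcs_c: "arcs C = {(u, v) \<in> parcs G. u \<in> verts C \<and> v \<in> verts C}" if "C \<in> sccs" for C
    using arg_cong[OF component_facts(1)[OF that], of arcs] by (simp add: case_prod_beta')
  have same: "c u = c v" if "(u, v) \<in> parcs G" for u v
  proof (rule ccontr)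
    assume "c u \<noteq> c v"
    then have "verts (c u) \<inter> verts (c v) = {}" using scc_disj c that in_arcsD1 in_arcsD2 by metis
    moreover have "v \<in> verts (c u)" using component_facts(4)[of "c u" u v] c that in_arcsD1 by metis
    ultimately show False using c that in_arcsD2 by blast
  qed
  have im: "arcs (c u) `` {u} = parcs G `` {u}" if "u \<in> pverts G" for u
    using arcs_c[of "c u"] c[OF that] component_facts(4)[of "c u" u] by auto
  have "0 \<le> W (c u) u v \<and> W (c u) u v = W (c v) v u" if "(u, v) \<in> parcs G" for u v
  proof -
    have "(u, v) \<in> arcs (c u)" using im[of u] that in_arcsD1 by auto
    then show ?thesis
      using W[of "c u"] c[of u] that in_arcsD1 same[OF that] by (auto simp: half_weighting_def)
  qed
  moreover have "1 \<le> sum (W (c u) u) (parcs G `` {u}) \<and> sum (W (c u) u) (parcs G `` {u}) \<le> real k + 1 / 2"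
    if "u \<in> pverts G" for u
    using W[of "c u"] c[OF that] im[OF that] by (auto simp: half_weighting_def)
  ultimately have "half_weighting k (pverts G) (parcs G) (\<lambda>u v. W (c u) u v)"
    by (auto simp: half_weighting_def)
  then show ?thesis by blast
qed

lemma iso_count_restrict:
  assumes "pair_graph G"
  shows "iso_count (with_proj G \<restriction> S) = card {v \<in> S. \<forall>u\<in>S. (v, u) \<notin> parcs G}"
proof -
  interpret pair_graph G by fact
  have "finite (parcs G `` {v})" for v
    by (rule finite_subset[OF _ pair_finite_verts]) (auto dest: in_arcsD2)
  then have "out_degree (with_proj G \<restriction> S) v = 0 \<longleftrightarrow> (\<forall>u\<in>S. (v, u) \<notin> parcs G)" if "v \<in> S" for v
  proof -
    have "arcs (with_proj G \<restriction> S) `` {v} \<subseteq> parcs G `` {v}" by auto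
    then have "finite (arcs (with_proj G \<restriction> S) `` {v})"
      using \<open>finite (parcs G `` {v})\<close> finite_subset by blast
    then show ?thesis using that by (auto simp: out_degree_pair)
  qed
  then show ?thesis by (auto simp: iso_count_def intro!: arg_cong[where f = card])
qed

lemma factor_imp_isolated_bound:
  assumes "2 \<le> k" "pair_graph G" and F: "is_factor (stars k \<union> T_trees k) F G" and "S \<subseteq> pverts G"
  shows "real (iso_count (with_proj G \<restriction> (pverts G - S))) \<le> (real k + 1 / 2) * real (card S)"
proof -
  interpret G: pair_graph G by fact
  interpret F: pair_graph F using F by (simp add: is_factor_def)
  have sub: "pverts F = pverts G" "parcs F \<subseteq> parcs G"
    using F by (auto simp: is_factor_def spanning_def subgraph_def)
  have "\<exists>w. half_weighting k (pverts F) (parcs F) w"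
  proof (rule F.half_weighting_of_components)
    fix C assume C: "C \<in> F.sccs"
    then obtain H where H: "H \<in> stars k \<union> T_trees k" "digraph_iso C (with_proj H)"
      using F by (auto simp: is_factor_def)
    note CF = F.component_facts[OF C]
    have wf: "wf_digraph C" using CF(1) F.wellformed_induce_subgraph by metis
    have th: "tail C = fst" "head C = snd"
      using arg_cong[OF CF(1), of tail] arg_cong[OF CF(1), of head] by simp_all
    obtain f where f: "inj_on f (verts C)" "pverts H = f ` verts C" "parcs H = map_prod f f ` arcs C"
      using H(2) unfolding digraph_iso_pair_iff[OF wf th] by blast
    have "arcs C \<subseteq> verts C \<times> verts C" using wf th by (auto simp: wf_digraph_def)
    moreover obtain w where "half_weighting k (pverts H) (parcs H) w"
      using half_weighting_member[OF H(1) \<open>2 \<le> k\<close>] by blast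
    ultimately have "half_weighting k (verts C) (arcs C) (\<lambda>u v. w (f u) (f v))"
      using half_weighting_iso[OF f(1)] f(2,3) by simp
    then show "\<exists>w. half_weighting k (verts C) (arcs C) w" by blast
  qed
  then obtain w where "half_weighting k (pverts F) (parcs F) w" by blast
  moreover have "parcs F \<subseteq> pverts F \<times> pverts F" using F.wellformed' by auto
  moreover have "sym (parcs F)" using F.arcs_symmetric by (auto intro: symI)
  \<comment> \<open>A vertex isolated in \<open>G\<close> without \<open>S\<close> has all its
    neighbours in \<open>G\<close>, hence also those in \<open>F\<close>, inside
    \<open>S\<close>.\<close>
  ultimately have "real (card {v \<in> pverts G - S. \<forall>u\<in>pverts G - S. (v, u) \<notin> parcs G})
      \<le> (real k + 1 / 2) * real (card S)"
    using sub \<open>S \<subseteq> pverts G\<close> G.in_arcsD2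
    by (intro isolated_le_of_half_weighting[of "pverts F" "parcs F" k w S]) auto
  then show ?thesis by (simp add: iso_count_restrict[OF assms(2)])
qed

section \<open>Components of the cover graph\<close>

text \<open>Along a closed walk the tails are the heads shifted cyclically by one place. The first
  three facts are what \<open>no_rotation\<close> asks of a cycle; the last makes different arcs of
  the walk belong to different edges.\<close>

lemma closed_pair_walk:
  assumes "pcas u p u" "p \<noteq> []" "distinct (map snd p)"
  shows "fst ` set p = snd ` set p" "inj_on fst (set p)" "inj_on snd (set p)"
    "3 \<le> length p \<Longrightarrow> e \<in> set p \<Longrightarrow> (snd e, fst e) \<notin> set p"
proof -
  have "map fst p = v # butlast (map snd p) \<and> last (map snd p) = w" if "pcas v p w" "p \<noteq> []" for v w
    using that by (induction p arbitrary: v) (auto split: if_splits)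
  then have fsts: "map fst p = u # butlast (map snd p)" and last: "last (map snd p) = u"
    using assms(1,2) by blast+
  have snds: "map snd p = butlast (map snd p) @ [u]"
    using last assms(2) append_butlast_last_id[of "map snd p"] by simp
  show "fst ` set p = snd ` set p"
    using arg_cong[OF fsts, of set] arg_cong[OF snds, of set] by simp
  have dfst: "distinct (map fst p)"
    using assms(3) unfolding fsts by (subst (asm) snds) simp
  show "inj_on fst (set p)" "inj_on snd (set p)" using dfst assms(3) by (simp_all add: distinct_map)
  have step: "fst (p ! (Suc i mod length p)) = snd (p ! i)" if "i < length p" for i
  proof (cases "Suc i = length p")
    case True
    then have "i = length p - 1" by simp
    then have "snd (p ! i) = u" using last assms(2) by (simp add: last_map last_conv_nth)
    moreover have "fst (p ! 0) = u" using arg_cong[OF fsts, of hd] assms(2) by (simp add: hd_map hd_conv_nth)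
    ultimately show ?thesis using True by simp
  next
    case False
    then have i: "Suc i < length p" using that by simp
    have "fst (p ! Suc i) = map fst p ! Suc i" using i by simp
    also have "\<dots> = snd (p ! i)" unfolding fsts using i by (simp add: nth_butlast)
    finally show ?thesis using i by simp
  qed
  show "(snd e, fst e) \<notin> set p" if len: "3 \<le> length p" and e: "e \<in> set p"
  proof
    assume "(snd e, fst e) \<in> set p"
    then obtain i j where ij: "i < length p" "p ! i = e" "j < length p" "p ! j = (snd e, fst e)"
      using e by (metis in_set_conv_nth)
    have eq: "i' = j'" if "fst (p ! i') = fst (p ! j')" "i' < length p" "j' < length p" for i' j'
      using dfst that by (auto simp: distinct_conv_nth)
    \<comment> \<open>An arc and its reverse would be cyclic successors of each other, which forces
      length at most 2.\<close>
    have "Suc i mod length p = j" "Suc j mod length p = i"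
      using step[of i] step[of j] ij assms(2) by (auto intro!: eq)
    then show False using ij(1,3) len by (auto simp: mod_Suc split: if_splits)
  qed
qed

section \<open>The spanning subgraph given by a tight allotment\<close>

context tight_allotment
begin

text \<open>The edges of the multigraph on \<open>A\<close>, each represented by the vertex that
  will subdivide it.\<close>

definition split :: "'a set" where
  "split = {b \<in> V - A. g b \<noteq> h b}"

text \<open>The vertices that become leaves of a star or of a tree \<open>R\<close>.\<close>

definition whole :: "'a set" where
  "whole = {b \<in> V - A. g b = h b}"

text \<open>The future factor: each sender is joined to its one or two receivers.\<close>

definition cover :: "'a pair_pre_digraph" where
  "cover = \<lparr>pverts = V, parcs = {(x, y). x \<in> V - A \<and> y \<in> {g x, h x} \<or> y \<in> V - A \<and> x \<in> {g y, h y}}\<rparr>"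

definition linked :: "'a \<Rightarrow> 'a \<Rightarrow> bool" where
  "linked x y \<longleftrightarrow> (\<exists>b\<in>split. {x, y} = {g b, h b})"

lemma pverts_cover [simp]: "pverts cover = V"
  by (simp add: cover_def)

lemma parcs_cover_iff:
  "(x, y) \<in> parcs cover \<longleftrightarrow> x \<in> V - A \<and> y \<in> {g x, h x} \<or> y \<in> V - A \<and> x \<in> {g y, h y}"
  by (simp add: cover_def)

lemma A_subset: "A \<subseteq> V"
  using allotment by (simp add: allotment_def)

lemma ends_in_A: "b \<in> V - A \<Longrightarrow> g b \<in> A" "b \<in> V - A \<Longrightarrow> h b \<in> A"
  using allotment by (auto simp: allotment_def)

lemma ends_neq: "b \<in> V - A \<Longrightarrow> g b \<noteq> b" "b \<in> V - A \<Longrightarrow> h b \<noteq> b"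
  using ends_in_A by fastforce+

lemma split_whole: "V - A = split \<union> whole" "split \<inter> whole = {}" "split \<subseteq> V - A" "whole \<subseteq> V - A"
  by (auto simp: split_def whole_def)

lemma finite_parts: "finite split" "finite whole" "finite A"
  using finite_V A_subset finite_subset by (auto simp: split_def whole_def)

lemma pair_graph_cover: "pair_graph cover"
proof -
  have sub: "parcs cover \<subseteq> V \<times> V"
  proof (rule subsetI, clarify)
    fix x y assume "(x, y) \<in> parcs cover"
    then have "x \<in> V - A \<and> y \<in> A \<or> y \<in> V - A \<and> x \<in> A"
      using ends_in_A[of x] ends_in_A[of y] by (auto simp: parcs_cover_iff)
    then show "x \<in> V \<and> y \<in> V" using A_subset by auto
  qed
  then have "finite (parcs cover)" using finite_V finite_subset by blast
  with sub show ?thesis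
    using finite_V ends_neq ends_neq[symmetric]
    by unfold_locales (auto simp: symmetric_def parcs_cover_iff intro!: symI)
qed

lemma cover_arcs_E:
  assumes "\<And>x y. E x y \<Longrightarrow> E y x" "(x, y) \<in> parcs cover"
  shows "E x y"
  using assms allotment by (auto simp: parcs_cover_iff allotment_def)

text \<open>Two parallel edges would form a directed cycle of length two, one taken from
  \<open>g b\<close> to \<open>h b\<close> and the other back.\<close>

lemma split_eqI:
  assumes "b \<in> split" "c \<in> split" "{g b, h b} = {g c, h c}"
  shows "b = c"
proof (rule ccontr)
  assume "b \<noteq> c"
  have "{b, c} = {}"
    by (rule no_rotation[of _ "\<lambda>x. if x = b then g b else h b" "\<lambda>x. if x = b then h b else g b"])
      (use assms \<open>b \<noteq> c\<close> in \<open>auto simp: split_def insert_commute\<close>)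
  then show False by simp
qed

text \<open>Without parallel edges, the neighbours of \<open>a\<close> in the multigraph correspond
  to its edges at \<open>a\<close>.\<close>

lemma card_linked: "card {y. linked a y} = card {b \<in> split. a \<in> {g b, h b}}"
proof -
  let ?B = "{b \<in> split. a \<in> {g b, h b}}"
  define other where "other b = (if g b = a then h b else g b)" for b
  have ends: "{a, other b} = {g b, h b}" if "b \<in> ?B" for b using that by (auto simp: other_def)
  have "inj_on other ?B"
  proof (rule inj_onI)
    fix b c assume b: "b \<in> ?B" and c: "c \<in> ?B" and "other b = other c"
    then have "{g b, h b} = {g c, h c}" by (simp only: ends[symmetric])
    then show "b = c" using split_eqI b c by blast
  qed
  moreover have "other ` ?B = {y. linked a y}"
  proof (intro equalityI subsetI)
    fix y assume "y \<in> other ` ?B"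
    then obtain b where "b \<in> ?B" "y = other b" by blast
    then show "y \<in> {y. linked a y}" using ends[of b] by (auto simp: linked_def)
  next
    fix y assume "y \<in> {y. linked a y}"
    then obtain b where "b \<in> split" "{a, y} = {g b, h b}" by (auto simp: linked_def)
    then have "b \<in> ?B \<and> other b = y" by (auto simp: other_def doubleton_eq_iff)
    then show "y \<in> other ` ?B" by blast
  qed
  ultimately show ?thesis using card_image[of other ?B] by simp
qed

text \<open>A split vertex gives one token to each end and a whole one gives two. So the load is the
  quantity bounded in \<open>admissible\<close>: degree in the multigraph plus twice the number of
  leaves.\<close>

lemma load_split_whole:
  "load (V - A) g h a = card {b \<in> split. a \<in> {g b, h b}} + 2 * card {b \<in> whole. g b = a}"
proof -
  have "load (V - A) g h a = load split g h a + load whole g h a"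
    unfolding load_def split_whole(1) using finite_parts split_whole(2) by (intro sum.union_disjoint)
  moreover have "load whole g h a = load whole g g a"
    unfolding load_def by (intro sum.cong) (auto simp: whole_def)
  moreover have "load split g h a = card {b \<in> split. a \<in> {g b, h b}}"
  proof -
    have "load split g h a = (\<Sum>b\<in>split. of_bool (a \<in> {g b, h b}))"
      unfolding load_def by (intro sum.cong) (auto simp: split_def)
    also have "\<dots> = card {b \<in> split. a \<in> {g b, h b}}"
      using finite_parts(1)
      by (simp only: sum_of_bool_eq of_nat_id Collect_conj_eq Collect_mem_eq)
    finally show ?thesis .
  qed
  ultimately show ?thesis using finite_parts(2) by (simp add: load_same)
qed

end

section \<open>Connected parts of the cover and the star case\<close>

text \<open>\<open>S\<close> stands for the vertex set of a component; \<open>S_connected\<close>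
  expresses connectedness through closed subsets instead of walks. The injection
  \<open>\<iota>\<close> renames vertices as numbers because \<open>T_trees\<close> is built from
  trees on \<open>nat\<close>.\<close>

locale connected_part = tight_allotment +
  fixes S :: "'a set" and \<iota> :: "'a \<Rightarrow> nat"
  assumes S_subset: "S \<subseteq> V" and S_nonempty: "S \<noteq> {}"
    and S_closed: "(x, y) \<in> parcs cover \<Longrightarrow> x \<in> S \<Longrightarrow> y \<in> S"
    and S_connected: "T \<subseteq> S \<Longrightarrow> T \<noteq> {} \<Longrightarrow> (\<And>x y. x \<in> T \<Longrightarrow> (x, y) \<in> parcs cover \<Longrightarrow> y \<in> T) \<Longrightarrow> T = S"
    and inj_\<iota>: "inj_on \<iota> V"
begin

definition arcs_S :: "('a \<times> 'a) set" where
  "arcs_S = {(x, y) \<in> parcs cover. x \<in> S \<and> y \<in> S}"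

lemma finite_S: "finite S"
  using S_subset finite_V finite_subset by blast

lemma S_closed_ends: "b \<in> S \<Longrightarrow> b \<in> V - A \<Longrightarrow> g b \<in> S" "b \<in> S \<Longrightarrow> b \<in> V - A \<Longrightarrow> h b \<in> S"
    "b \<in> V - A \<Longrightarrow> g b \<in> S \<Longrightarrow> b \<in> S" "b \<in> V - A \<Longrightarrow> h b \<in> S \<Longrightarrow> b \<in> S"
  using S_closed by (auto simp: parcs_cover_iff)

text \<open>The centre \<open>a\<close> with its leaves is closed under adjacency and hence is all
  of \<open>S\<close>. Its load is even, twice the number of leaves, so the bounds 1 and
  \<open>2 * k + 1\<close> leave between 1 and \<open>k\<close> leaves.\<close>

lemma star_part:
  assumes a: "a \<in> A \<inter> S" and no_split: "\<And>b. b \<in> split \<Longrightarrow> a \<notin> {g b, h b}"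
  shows "\<exists>H \<in> stars k. \<exists>f :: 'a \<Rightarrow> nat tvert. inj_on f S \<and> pverts H = f ` S \<and> parcs H = map_prod f f ` arcs_S"
proof -
  define L where "L = {b \<in> whole. g b = a}"
  have LS: "L \<subseteq> S" using a S_closed_ends(3) by (auto simp: L_def whole_def)
  have "insert a L = S"
  proof (rule S_connected)
    fix x y assume "x \<in> insert a L" "(x, y) \<in> parcs cover"
    then show "y \<in> insert a L"
      using a no_split[of y] ends_in_A[of y] by (auto simp: L_def parcs_cover_iff whole_def split_def)
  qed (use a LS in auto)
  then have mem: "x \<in> S \<longleftrightarrow> x = a \<or> x \<in> L" for x by blast
  have "a \<notin> L" using a by (auto simp: L_def whole_def)
  have "(x, y) \<in> arcs_S \<longleftrightarrow> x = a \<and> y \<in> L \<or> x \<in> L \<and> y = a" for x y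
    using a mem[of x] mem[of y] ends_in_A[of x] ends_in_A[of y]
    by (auto simp: L_def arcs_S_def parcs_cover_iff whole_def)
  then have arcs: "arcs_S = {a} \<times> L \<union> L \<times> {a}" by auto
  define f where "f x = Old (\<iota> x)" for x
  have inj: "inj_on f S" using inj_on_subset[OF inj_\<iota> S_subset] by (simp add: f_def inj_on_def)
  define H where "H = \<lparr>pverts = f ` S, parcs = map_prod f f ` arcs_S\<rparr>"
  have card: "card (f ` L) = card L" using inj LS by (meson card_image inj_on_subset)
  have "{b \<in> split. a \<in> {g b, h b}} = {}" using no_split by blast
  then have "load (V - A) g h a = 2 * card L" by (simp only: load_split_whole card.empty add_0 L_def)
  moreover have "1 \<le> load (V - A) g h a" "load (V - A) g h a \<le> 2 * k + 1"
    using allotment a by (auto simp: allotment_def)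
  ultimately have "card L \<in> {1..k}" by auto
  moreover have "complete_bipartite_digraph 1 (card L) (with_proj H)"
    unfolding complete_bipartite_digraph_pair_def
  proof (intro conjI exI)
    show "finite (pverts H)" using finite_S by (simp add: H_def)
    show "pverts H = {f a} \<union> f ` L" using mem by (auto simp: H_def)
    show "{f a} \<inter> f ` L = {}" using \<open>a \<notin> L\<close> inj a LS by (fastforce dest: inj_onD)
    show "card {f a} = 1" by simp
    show "card (f ` L) = card L" by (rule card)
    show "parcs H = {f a} \<times> f ` L \<union> f ` L \<times> {f a}"
      by (auto simp: H_def arcs)
  qed
  ultimately have "H \<in> stars k" by (auto simp: stars_def)
  then show ?thesis using inj by (intro bexI[of _ H] exI[of _ f]) (auto simp: H_def)
qed

end

section \<open>The tree case\<close>

text \<open>The case complementary to \<open>star_part\<close>: every centre is an end of a split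
  vertex, so its load is \<open>2 * k + 1\<close> by \<open>full\<close>.\<close>

locale tree_part = connected_part +
  assumes has_split: "a \<in> A \<inter> S \<Longrightarrow> \<exists>b\<in>split. a \<in> {g b, h b}"
begin

definition links :: "('a \<times> 'a) set" where
  "links = {(x, y). x \<in> S \<and> y \<in> S \<and> linked x y}"

definition pendant :: "('a \<times> 'a) set" where
  "pendant = {(x, y). x \<in> S \<and> y \<in> S \<and> (x \<in> whole \<and> y = g x \<or> y \<in> whole \<and> x = g y)}"

text \<open>The tree \<open>R\<close> behind the component. Split vertices are left out, since
  \<open>T_of\<close> restores them as subdivisions of the core edges \<open>links\<close>.\<close>

definition skeleton :: "nat pair_pre_digraph" where
  "skeleton = \<lparr>pverts = \<iota> ` (S - split), parcs = map_prod \<iota> \<iota> ` (links \<union> pendant)\<rparr>"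

lemma \<iota>_eq_iff: "x \<in> S \<Longrightarrow> y \<in> S \<Longrightarrow> \<iota> x = \<iota> y \<longleftrightarrow> x = y"
  using inj_\<iota> S_subset by (auto simp: inj_on_def)

lemma linked_sym: "linked x y \<Longrightarrow> linked y x"
  by (auto simp: linked_def insert_commute)

lemma linkedD: "linked x y \<Longrightarrow> x \<in> A \<and> y \<in> A \<and> x \<noteq> y"
  using ends_in_A by (auto simp: linked_def split_def doubleton_eq_iff)

lemma linked_S: "linked x y \<Longrightarrow> x \<in> S \<Longrightarrow> y \<in> S"
  using S_closed_ends by (auto simp: linked_def split_def doubleton_eq_iff)

lemma wholeD:
  assumes "b \<in> whole"
  shows "b \<notin> A" "b \<notin> split" "g b \<in> A" "h b = g b" "g b \<noteq> b" "b \<in> V - A"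
  using assms ends_in_A[of b] by (auto simp: whole_def split_def)

lemma S_cases: "x \<in> S \<Longrightarrow> x \<in> A \<or> x \<in> whole \<or> x \<in> split"
  using S_subset split_whole(1) by auto

lemma A_not_split: "x \<in> A \<Longrightarrow> x \<notin> split \<and> x \<notin> whole"
  by (auto simp: whole_def split_def)

lemma skeleton_simps:
  "pverts skeleton = \<iota> ` (S - split)" "parcs skeleton = map_prod \<iota> \<iota> ` (links \<union> pendant)"
  by (simp_all add: skeleton_def)

lemma arcs_ends_S: "(x, y) \<in> links \<union> pendant \<Longrightarrow> x \<in> S - split \<and> y \<in> S - split \<and> x \<noteq> y"
proof -
  assume "(x, y) \<in> links \<union> pendant"
  then have xy: "x \<in> S" "y \<in> S" "linked x y \<or> x \<in> whole \<and> y = g x \<or> y \<in> whole \<and> x = g y"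
    unfolding links_def pendant_def by blast+
  have pend: "b \<notin> split \<and> g b \<notin> split \<and> g b \<noteq> b" if "b \<in> whole" for b
    using wholeD[OF that] A_not_split by blast
  show ?thesis
    using xy linkedD[of x y] A_not_split[of x] A_not_split[of y] pend[of x] pend[of y]
    by (metis DiffI)
qed

lemma skeleton_arc_iff:
  assumes "x \<in> S" "y \<in> S"
  shows "(\<iota> x, \<iota> y) \<in> parcs skeleton \<longleftrightarrow> linked x y \<or> x \<in> whole \<and> y = g x \<or> y \<in> whole \<and> x = g y"
proof -
  have "(\<iota> x, \<iota> y) \<in> parcs skeleton \<longleftrightarrow> (x, y) \<in> links \<union> pendant"
  proof
    assume "(\<iota> x, \<iota> y) \<in> parcs skeleton"
    then obtain x' y' where xy: "(x', y') \<in> links \<union> pendant" "\<iota> x = \<iota> x'" "\<iota> y = \<iota> y'"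
      unfolding skeleton_simps by auto
    then have "x' = x" "y' = y" using assms arcs_ends_S[OF xy(1)] \<iota>_eq_iff by blast+
    then show "(x, y) \<in> links \<union> pendant" using xy(1) by simp
  qed (auto simp: skeleton_simps)
  then show ?thesis using assms by (auto simp: links_def pendant_def)
qed

lemma skeleton_arcE:
  assumes "(u, v) \<in> parcs skeleton"
  obtains x y where "u = \<iota> x" "v = \<iota> y" "x \<in> S - split" "y \<in> S - split" "x \<noteq> y"
    "linked x y \<or> x \<in> whole \<and> y = g x \<or> y \<in> whole \<and> x = g y"
proof -
  obtain x y where "u = \<iota> x" "v = \<iota> y" "(x, y) \<in> links \<union> pendant"
    using assms by (auto simp: skeleton_simps)
  then show thesis using that[of x y] arcs_ends_S[of x y] by (auto simp: links_def pendant_def)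
qed

lemma sym_arcs: "(x, y) \<in> links \<union> pendant \<Longrightarrow> (y, x) \<in> links \<union> pendant"
  using linked_sym by (auto simp: links_def pendant_def)

lemma pair_graph_skeleton: "pair_graph skeleton"
proof
  show "finite (pverts skeleton)" using finite_S by (simp add: skeleton_simps)
  have "links \<union> pendant \<subseteq> S \<times> S" by (auto simp: links_def pendant_def)
  then show "finite (parcs skeleton)"
    using finite_S finite_subset by (auto simp: skeleton_simps)
  show "fst e \<in> pverts skeleton" "snd e \<in> pverts skeleton" "fst e \<noteq> snd e"
    if "e \<in> parcs skeleton" for e
  proof -
    obtain u v where uv: "e = (u, v)" by (cases e)
    have "(u, v) \<in> parcs skeleton" using that uv by simp
    then obtain x y where "u = \<iota> x" "v = \<iota> y" "x \<in> S - split" "y \<in> S - split" "x \<noteq> y"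
      by (rule skeleton_arcE)
    then show "fst e \<in> pverts skeleton" "snd e \<in> pverts skeleton" "fst e \<noteq> snd e"
      using \<iota>_eq_iff[of x y] uv by (simp_all add: skeleton_simps(1))
  qed
  have "sym (parcs skeleton)"
  proof (rule symI)
    fix u v assume "(u, v) \<in> parcs skeleton"
    then obtain x y where "u = \<iota> x" "v = \<iota> y" "(y, x) \<in> links \<union> pendant"
      unfolding skeleton_simps using sym_arcs by auto
    then show "(v, u) \<in> parcs skeleton" unfolding skeleton_simps by force
  qed
  then show "symmetric (with_proj skeleton)" by (simp add: symmetric_def)
qed

lemma neighbours_whole:
  assumes "b \<in> whole \<inter> S"
  shows "parcs skeleton `` {\<iota> b} = {\<iota> (g b)}"
proof -
  have b: "b \<in> S" "b \<in> whole" "b \<notin> A" "g b \<in> S" "g b \<in> A"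
    using assms S_closed_ends(1)[of b] wholeD[of b] by blast+
  show ?thesis
  proof (intro equalityI subsetI)
    fix v assume "v \<in> parcs skeleton `` {\<iota> b}"
    then have "(\<iota> b, v) \<in> parcs skeleton" by simp
    then obtain y where y: "v = \<iota> y" "y \<in> S" by (elim skeleton_arcE) blast
    then have "linked b y \<or> y = g b \<or> y \<in> whole \<and> b = g y"
      using skeleton_arc_iff[of b y] b \<open>(\<iota> b, v) \<in> parcs skeleton\<close> by blast
    then have "y = g b" using b linkedD[of b y] wholeD(3)[of y] by blast
    then show "v \<in> {\<iota> (g b)}" using y by simp
  qed (use skeleton_arc_iff[of b "g b"] b in auto)
qed

lemma neighbours_A:
  assumes "a \<in> A \<inter> S"
  shows "parcs skeleton `` {\<iota> a} = \<iota> ` {y. linked a y} \<union> \<iota> ` {b \<in> whole. g b = a}"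
proof (intro equalityI subsetI)
  fix v assume "v \<in> parcs skeleton `` {\<iota> a}"
  then have v: "(\<iota> a, v) \<in> parcs skeleton" by simp
  then obtain y where y: "v = \<iota> y" "y \<in> S" by (elim skeleton_arcE) blast
  then have "linked a y \<or> y \<in> whole \<and> a = g y"
    using skeleton_arc_iff[of a y] assms v A_not_split[of a] by auto
  then show "v \<in> \<iota> ` {y. linked a y} \<union> \<iota> ` {b \<in> whole. g b = a}" using y by auto
next
  fix v assume "v \<in> \<iota> ` {y. linked a y} \<union> \<iota> ` {b \<in> whole. g b = a}"
  then obtain y where y: "v = \<iota> y" "linked a y \<or> y \<in> whole \<and> g y = a" by blast
  have "y \<in> S" using y(2) linked_S[of a y] S_closed_ends(3)[of y] assms by (auto simp: whole_def)
  then show "v \<in> parcs skeleton `` {\<iota> a}" using skeleton_arc_iff[of a y] y assms by auto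
qed

lemma part_S: "a \<in> A \<inter> S \<Longrightarrow> {y. linked a y} \<subseteq> S \<inter> A" "a \<in> A \<inter> S \<Longrightarrow> {b \<in> whole. g b = a} \<subseteq> S \<inter> whole"
  using linked_S linkedD S_closed_ends(3) by (auto simp: whole_def)

lemma inj_S: "inj_on \<iota> S"
  using inj_\<iota> S_subset inj_on_subset by blast

text \<open>The full load of a centre, read through \<open>load_split_whole\<close>.\<close>

lemma degree_sum:
  assumes "a \<in> A \<inter> S"
  shows "card {y. linked a y} + 2 * card {b \<in> whole. g b = a} = 2 * k + 1" "1 \<le> card {y. linked a y}"
proof -
  obtain b where b: "b \<in> split" "a \<in> {g b, h b}" using has_split[OF assms] by blast
  have "load (V - A) g h a = 2 * k + 1" using full[of b a] b by (simp add: split_def)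
  then show "card {y. linked a y} + 2 * card {b \<in> whole. g b = a} = 2 * k + 1"
    by (simp only: load_split_whole card_linked)
  have "b \<in> {b \<in> split. a \<in> {g b, h b}}" using b by simp
  moreover have "finite {b \<in> split. a \<in> {g b, h b}}" using finite_parts(1) by simp
  ultimately show "1 \<le> card {y. linked a y}"
    unfolding card_linked by (metis One_nat_def Suc_leI card_gt_0_iff empty_iff)
qed

text \<open>A centre with core degree \<open>d\<close> and \<open>l\<close> leaves has
  \<open>d + 2 * l = 2 * k + 1\<close> and \<open>d \<ge> 1\<close>, so its degree
  \<open>d + l\<close> could be 1 only for \<open>k = 0\<close>.\<close>

lemma Leaf_skeleton:
  assumes "1 \<le> k"
  shows "Leaf skeleton = \<iota> ` (S \<inter> whole)"
proof -
  have leaf: "\<iota> x \<in> Leaf skeleton \<longleftrightarrow> x \<in> whole" if x: "x \<in> S - split" for x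
  proof (cases "x \<in> whole")
    case True
    then show ?thesis using x neighbours_whole[of x] by (simp add: Leaf_def out_degree_pair skeleton_simps(1))
  next
    case False
    then have xA: "x \<in> A \<inter> S" using x S_cases by auto
    have "card (parcs skeleton `` {\<iota> x}) =
        card (\<iota> ` {y. linked x y}) + card (\<iota> ` {b \<in> whole. g b = x})"
      unfolding neighbours_A[OF xA]
    proof (rule card_Un_disjoint)
      show "finite (\<iota> ` {y. linked x y})" "finite (\<iota> ` {b \<in> whole. g b = x})"
        using part_S[OF xA] finite_S by (auto intro: finite_subset)
      show "\<iota> ` {y. linked x y} \<inter> \<iota> ` {b \<in> whole. g b = x} = {}"
        using part_S[OF xA] wholeD inj_S by (fastforce dest: inj_onD)
    qed
    also have "\<dots> = card {y. linked x y} + card {b \<in> whole. g b = x}"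
      using part_S[OF xA] inj_on_subset[OF inj_S] by (simp add: card_image)
    finally have "out_degree (with_proj skeleton) (\<iota> x) \<noteq> 1"
      using degree_sum[OF xA] assms by (simp add: out_degree_pair)
    then show ?thesis using False by (simp add: Leaf_def)
  qed
  show ?thesis
  proof (intro equalityI subsetI)
    fix v assume v: "v \<in> Leaf skeleton"
    then obtain x where "v = \<iota> x" "x \<in> S - split" by (auto simp: Leaf_def skeleton_simps(1))
    then show "v \<in> \<iota> ` (S \<inter> whole)" using leaf v by auto
  next
    fix v assume "v \<in> \<iota> ` (S \<inter> whole)"
    then show "v \<in> Leaf skeleton" using leaf wholeD by auto
  qed
qed

lemma core_skeleton:
  assumes "1 \<le> k"
  shows "verts (core skeleton) = \<iota> ` (S \<inter> A)" "arcs (core skeleton) = map_prod \<iota> \<iota> ` links"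
proof -
  have "S - split - (S \<inter> whole) = S \<inter> A" using S_cases A_not_split by auto
  then show v: "verts (core skeleton) = \<iota> ` (S \<inter> A)"
    unfolding core_simps Leaf_skeleton[OF assms] skeleton_simps(1)
    using inj_on_image_set_diff[OF inj_S, of "S - split" "S \<inter> whole"] by auto
  have "arcs (core skeleton) = {(u, v) \<in> parcs skeleton. u \<in> \<iota> ` (S \<inter> A) \<and> v \<in> \<iota> ` (S \<inter> A)}"
    unfolding v[symmetric] by (auto simp: core_simps)
  also have "\<dots> = map_prod \<iota> \<iota> ` links"
  proof (intro equalityI subsetI)
    fix e assume "e \<in> {(u, v) \<in> parcs skeleton. u \<in> \<iota> ` (S \<inter> A) \<and> v \<in> \<iota> ` (S \<inter> A)}"
    then obtain x y where xy: "e = (\<iota> x, \<iota> y)" "x \<in> S \<inter> A" "y \<in> S \<inter> A" "(\<iota> x, \<iota> y) \<in> parcs skeleton"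
      by auto
    then have "linked x y" using skeleton_arc_iff[of x y] A_not_split by auto
    then show "e \<in> map_prod \<iota> \<iota> ` links" using xy by (auto simp: links_def)
  next
    fix e assume "e \<in> map_prod \<iota> \<iota> ` links"
    then show "e \<in> {(u, v) \<in> parcs skeleton. u \<in> \<iota> ` (S \<inter> A) \<and> v \<in> \<iota> ` (S \<inter> A)}"
      using linkedD by (auto simp: skeleton_simps(2) links_def)
  qed
  finally show "arcs (core skeleton) = map_prod \<iota> \<iota> ` links" .
qed

lemma core_degree:
  assumes "1 \<le> k" "a \<in> A \<inter> S"
  shows "out_degree (core skeleton) (\<iota> a) = card {y. linked a y}"
proof -
  have "(map_prod \<iota> \<iota> ` links) `` {\<iota> a} = \<iota> ` {y. linked a y}"
    using assms(2) part_S(1)[OF assms(2)] by (auto simp: links_def \<iota>_eq_iff)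
  then show ?thesis
    using part_S(1)[OF assms(2)] inj_on_subset[OF inj_S]
    by (simp add: out_degree_pair core_simps(3) core_skeleton[OF assms(1)] card_image)
qed

lemma leaf_count_skeleton:
  assumes "1 \<le> k" "a \<in> A \<inter> S"
  shows "leaf_count skeleton (\<iota> a) = card {b \<in> whole. g b = a}"
proof -
  have "{u \<in> Leaf skeleton. (\<iota> a, u) \<in> parcs skeleton} = \<iota> ` {b \<in> whole. g b = a}"
  proof (intro equalityI subsetI)
    fix u assume "u \<in> {u \<in> Leaf skeleton. (\<iota> a, u) \<in> parcs skeleton}"
    then obtain b where b: "u = \<iota> b" "b \<in> S \<inter> whole" "(\<iota> a, \<iota> b) \<in> parcs skeleton"
      using Leaf_skeleton[OF assms(1)] by auto
    then have "g b = a"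
      using skeleton_arc_iff[of a b] assms(2) linkedD[of a b] wholeD[of b] A_not_split[of a] by auto
    then show "u \<in> \<iota> ` {b \<in> whole. g b = a}" using b by auto
  next
    fix u assume "u \<in> \<iota> ` {b \<in> whole. g b = a}"
    then show "u \<in> {u \<in> Leaf skeleton. (\<iota> a, u) \<in> parcs skeleton}"
      using part_S(2)[OF assms(2)] neighbours_A[OF assms(2)] Leaf_skeleton[OF assms(1)] by auto
  qed
  then show ?thesis
    using part_S(2)[OF assms(2)] inj_on_subset[OF inj_S] by (simp add: leaf_count_def card_image)
qed

lemma connected_skeleton: "connected (with_proj skeleton)"
proof -
  interpret R: pair_graph skeleton by (rule pair_graph_skeleton)
  \<comment> \<open>Contracting a split vertex to its end \<open>g x\<close> turns cover edges into
    edges or single vertices of the skeleton, so connectedness is inherited.\<close>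
  define \<pi> where "\<pi> x = \<iota> (if x \<in> split then g x else x)" for x
  have \<pi>_verts: "\<pi> x \<in> pverts skeleton" if "x \<in> S" for x
    using that S_closed_ends(1)[of x] ends_in_A A_not_split
    by (auto simp: \<pi>_def skeleton_simps(1) split_def)
  have step: "\<pi> x \<rightarrow>\<^sup>*\<^bsub>with_proj skeleton\<^esub> \<pi> y" if xy: "x \<in> S" "y \<in> S" "(x, y) \<in> parcs cover" for x y
  proof -
    have "\<pi> b \<rightarrow>\<^sup>*\<^bsub>with_proj skeleton\<^esub> \<pi> a" if ab: "b \<in> V - A" "b \<in> S" "a \<in> S" "a \<in> {g b, h b}" for a b
    proof -
      have aA: "a \<in> A" using ab ends_in_A by auto
      then have \<pi>a: "\<pi> a = \<iota> a" using A_not_split by (simp add: \<pi>_def)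
      consider "b \<in> whole" | "b \<in> split" "a = g b" | "b \<in> split" "a = h b"
        using ab split_whole(1) by blast
      then show ?thesis
      proof cases
        case 1
        then have "(\<pi> b, \<pi> a) \<in> parcs skeleton"
          using neighbours_whole[of b] ab wholeD[of b] \<pi>a by (auto simp: \<pi>_def)
        then show ?thesis by (auto intro: R.reachable_adjI)
      next
        case 2
        then show ?thesis using \<pi>a \<pi>_verts[OF ab(3)] by (simp add: \<pi>_def)
      next
        case 3
        then have "linked (g b) a" by (auto simp: linked_def)
        then have "(\<pi> b, \<pi> a) \<in> parcs skeleton"
          using 3 \<pi>a skeleton_arc_iff[of "g b" a] ab S_closed_ends(1)[of b] by (auto simp: \<pi>_def)
        then show ?thesis by (auto intro: R.reachable_adjI)
      qed
    qed
    then show ?thesis using xy R.symmetric_reachable' by (auto simp: parcs_cover_iff)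
  qed
  have reach: "\<pi> x \<rightarrow>\<^sup>*\<^bsub>with_proj skeleton\<^esub> \<pi> y" if "x \<in> S" "y \<in> S" for x y
  proof -
    have "{y \<in> S. \<pi> x \<rightarrow>\<^sup>*\<^bsub>with_proj skeleton\<^esub> \<pi> y} = S"
    proof (rule S_connected)
      show "{y \<in> S. \<pi> x \<rightarrow>\<^sup>*\<^bsub>with_proj skeleton\<^esub> \<pi> y} \<noteq> {}"
        using that(1) \<pi>_verts[OF that(1)] by blast
      show "z \<in> {y \<in> S. \<pi> x \<rightarrow>\<^sup>*\<^bsub>with_proj skeleton\<^esub> \<pi> y}"
        if "y \<in> {y \<in> S. \<pi> x \<rightarrow>\<^sup>*\<^bsub>with_proj skeleton\<^esub> \<pi> y}" "(y, z) \<in> parcs cover" for y z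
        using that step[of y z] S_closed R.reachable_trans by blast
    qed blast
    then show ?thesis using that(2) by blast
  qed
  have "u \<rightarrow>\<^sup>*\<^bsub>with_proj skeleton\<^esub> v" if uv: "u \<in> pverts skeleton" "v \<in> pverts skeleton" for u v
  proof -
    obtain x y where xy: "u = \<iota> x" "v = \<iota> y" "x \<in> S - split" "y \<in> S - split"
      using uv unfolding skeleton_simps(1) by blast
    then show ?thesis using reach[of x y] by (simp add: \<pi>_def)
  qed
  moreover have "pverts skeleton \<noteq> {}" using S_nonempty \<pi>_verts by blast
  \<comment> \<open>\<open>connected\<close> refers to the symmetrised graph, which has the same
    reachability here.\<close>
  moreover have "u \<rightarrow>\<^sup>*\<^bsub>with_proj (mk_symmetric (with_proj skeleton))\<^esub> v \<longleftrightarrow> u \<rightarrow>\<^sup>*\<^bsub>with_proj skeleton\<^esub> v" for u v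
    using R.reachable_mk_symmetric_eq[OF R.pair_sym_arcs] by simp
  ultimately show ?thesis by (auto simp: connected_def strongly_connected_def)
qed

text \<open>A cycle of length at least 3 meets no leaf and uses no edge twice, so its arcs come from
  distinct split vertices. Oriented along the cycle, these contradict
  \<open>no_rotation\<close>.\<close>

lemma acyclic_skeleton: "\<not> (\<exists>p. pre_digraph.cycle (with_proj skeleton) p \<and> 3 \<le> length p)"
proof
  interpret R: pair_graph skeleton by (rule pair_graph_skeleton)
  assume "\<exists>p. R.cycle p \<and> 3 \<le> length p"
  then obtain p u where p: "pcas u p u" "set p \<subseteq> parcs skeleton" "distinct (tl (pawalk_verts u p))"
      "p \<noteq> []" "3 \<le> length p"
    by (auto simp: R.cycle_def R.awalk_def)
  have "distinct (map snd p)" using p(1,3,4) R.awalk_verts_conv'[of u p u] by simp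
  note walk = closed_pair_walk[OF p(1,4) this]
  note no_rev = walk(4)[OF p(5)]
  define j where "j = inv_into S \<iota>"
  have j: "j (\<iota> x) = x" if "x \<in> S" for x using that inj_S by (simp add: j_def)
  have link: "\<exists>b\<in>split. {j (fst e), j (snd e)} = {g b, h b}" if e: "e \<in> set p" for e
  proof -
    obtain x y where xy: "e = (\<iota> x, \<iota> y)" "x \<in> S" "y \<in> S"
        "linked x y \<or> x \<in> whole \<and> y = g x \<or> y \<in> whole \<and> x = g y"
    proof -
      obtain u v where uv: "e = (u, v)" by (cases e)
      then have "(u, v) \<in> parcs skeleton" using e p(2) by blast
      then show thesis by (elim skeleton_arcE) (use uv that in blast)
    qed
    \<comment> \<open>A leaf would be entered and left through its only neighbour, so the cycle
      would contain an arc and its reverse.\<close>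
    have "x \<notin> whole"
    proof
      assume x: "x \<in> whole"
      have "\<iota> x \<in> snd ` set p" using walk(1) e xy(1) by force
      then obtain z where z: "(z, \<iota> x) \<in> set p" by force
      then have "(\<iota> x, z) \<in> parcs skeleton" using p(2) R.arcs_symmetric by blast
      then have "z = \<iota> (g x)" using neighbours_whole[of x] x xy(2) by blast
      moreover have "\<iota> y = \<iota> (g x)" using neighbours_whole[of x] x xy(1,2) e p(2) by blast
      ultimately show False using no_rev[OF e] z xy(1) by simp
    qed
    moreover have "y \<notin> whole"
    proof
      assume y: "y \<in> whole"
      have "\<iota> y \<in> fst ` set p" using walk(1) e xy(1) by force
      then obtain z where z: "(\<iota> y, z) \<in> set p" by force
      then have "z = \<iota> (g y)" using neighbours_whole[of y] y xy(3) p(2) by blast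
      moreover have "(\<iota> y, \<iota> x) \<in> parcs skeleton" using e xy(1) p(2) R.arcs_symmetric by blast
      then have "\<iota> x = \<iota> (g y)" using neighbours_whole[of y] y xy(3) by blast
      ultimately show False using no_rev[OF e] z xy(1) by simp
    qed
    ultimately have "linked x y" using xy(4) by blast
    then show ?thesis using xy(1) j[OF xy(2)] j[OF xy(3)] by (simp add: linked_def)
  qed
  \<comment> \<open>\<open>\<beta> e\<close> is the split vertex that the arc \<open>e\<close> comes
    from. Arcs with the same \<open>\<beta>\<close> are equal or reverse to each other, and
    \<open>no_rev\<close> excludes the latter.\<close>
  then obtain \<beta> where \<beta>: "\<And>e. e \<in> set p \<Longrightarrow> \<beta> e \<in> split \<and> {j (fst e), j (snd e)} = {g (\<beta> e), h (\<beta> e)}"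
    by metis
  have ends: "fst e \<in> \<iota> ` S" "snd e \<in> \<iota> ` S" if "e \<in> set p" for e
  proof -
    obtain u v where uv: "e = (u, v)" by (cases e)
    then have "(u, v) \<in> parcs skeleton" using that p(2) by blast
    then show "fst e \<in> \<iota> ` S" "snd e \<in> \<iota> ` S" unfolding uv by (auto elim!: skeleton_arcE)
  qed
  have inj_j: "inj_on j (\<iota> ` S)" using j by (auto simp: inj_on_def)
  have inj_\<beta>: "inj_on \<beta> (set p)"
  proof (rule inj_onI)
    fix e e' assume e: "e \<in> set p" "e' \<in> set p" "\<beta> e = \<beta> e'"
    then have "{j (fst e), j (snd e)} = {j (fst e'), j (snd e')}" using \<beta> by metis
    then consider "j (fst e) = j (fst e')" | "j (fst e) = j (snd e')" "j (snd e) = j (fst e')"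
      by (auto simp: doubleton_eq_iff)
    then show "e = e'"
    proof cases
      case 1
      then have "fst e = fst e'" using inj_onD[OF inj_j _ ends(1)[OF e(1)] ends(1)[OF e(2)]] by blast
      then show ?thesis using inj_onD[OF walk(2) _ e(1,2)] by blast
    next
      case 2
      then have "fst e = snd e'" "snd e = fst e'"
        using inj_onD[OF inj_j _ ends(1)[OF e(1)] ends(2)[OF e(2)]]
          inj_onD[OF inj_j _ ends(2)[OF e(1)] ends(1)[OF e(2)]] by blast+
      then show ?thesis using no_rev[OF e(1)] e(2) by simp
    qed
  qed
  \<comment> \<open>The inverse of \<open>\<beta>\<close> makes start and end of an arc into maps on
    split vertices, as \<open>no_rotation\<close> requires.\<close>
  define \<epsilon> where "\<epsilon> = inv_into (set p) \<beta>"
  have \<epsilon>: "\<epsilon> (\<beta> e) = e" if "e \<in> set p" for e using that inj_\<beta> by (simp add: \<epsilon>_def)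
  have "\<beta> ` set p = {}"
  proof (rule no_rotation[of _ "\<lambda>b. j (fst (\<epsilon> b))" "\<lambda>b. j (snd (\<epsilon> b))"])
    show "\<beta> ` set p \<subseteq> {b \<in> V - A. g b \<noteq> h b}" using \<beta> unfolding split_def by blast
    show "\<forall>b\<in>\<beta> ` set p. {j (fst (\<epsilon> b)), j (snd (\<epsilon> b))} = {g b, h b}" using \<beta> \<epsilon> by simp
    show "inj_on (\<lambda>b. j (fst (\<epsilon> b))) (\<beta> ` set p)"
    proof (rule inj_onI)
      fix b c assume "b \<in> \<beta> ` set p" "c \<in> \<beta> ` set p" and eq: "j (fst (\<epsilon> b)) = j (fst (\<epsilon> c))"
      then obtain e e' where e: "b = \<beta> e" "c = \<beta> e'" "e \<in> set p" "e' \<in> set p" by blast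
      then have "fst e = fst e'" using eq inj_onD[OF inj_j _ ends(1)[OF e(3)] ends(1)[OF e(4)]] \<epsilon> by simp
      then show "b = c" using e inj_onD[OF walk(2)] by blast
    qed
    show "inj_on (\<lambda>b. j (snd (\<epsilon> b))) (\<beta> ` set p)"
    proof (rule inj_onI)
      fix b c assume "b \<in> \<beta> ` set p" "c \<in> \<beta> ` set p" and eq: "j (snd (\<epsilon> b)) = j (snd (\<epsilon> c))"
      then obtain e e' where e: "b = \<beta> e" "c = \<beta> e'" "e \<in> set p" "e' \<in> set p" by blast
      then have "snd e = snd e'" using eq inj_onD[OF inj_j _ ends(2)[OF e(3)] ends(2)[OF e(4)]] \<epsilon> by simp
      then show "b = c" using e inj_onD[OF walk(3)] by blast
    qed
    have "(\<lambda>b. j (fst (\<epsilon> b))) ` \<beta> ` set p = j ` fst ` set p"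
      unfolding image_image using \<epsilon> by (intro image_cong) auto
    also have "\<dots> = j ` snd ` set p" by (simp only: walk(1))
    also have "\<dots> = (\<lambda>b. j (snd (\<epsilon> b))) ` \<beta> ` set p"
      unfolding image_image using \<epsilon> by (intro image_cong) auto
    finally show "(\<lambda>b. j (fst (\<epsilon> b))) ` \<beta> ` set p = (\<lambda>b. j (snd (\<epsilon> b))) ` \<beta> ` set p" .
  qed
  then show False using p(4) by simp
qed

lemma admissible_skeleton:
  assumes "1 \<le> k"
  shows "admissible k skeleton"
  unfolding admissible_def
proof (intro conjI ballI)
  show "graph_tree skeleton"
    unfolding graph_tree_def using pair_graph_skeleton connected_skeleton acyclic_skeleton by blast
  fix v assume "v \<in> verts (core skeleton)"
  then obtain a where a: "v = \<iota> a" "a \<in> A \<inter> S" using core_skeleton(1)[OF assms] by auto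
  let ?l = "card {b \<in> whole. g b = a}" and ?d = "card {y. linked a y}"
  have "?d = 2 * (k - ?l) + 1" using degree_sum[OF a(2)] by auto
  moreover have "out_degree (core skeleton) v = ?d" using core_degree[OF assms a(2)] a(1) by simp
  ultimately show "out_degree (core skeleton) v \<in> {2 * r + 1 | r. r \<le> k}" by auto
  show "2 * leaf_count skeleton v + out_degree (core skeleton) v \<le> 2 * k + 1"
    using core_degree[OF assms a(2)] leaf_count_skeleton[OF assms a(2)] a(1) degree_sum[OF a(2)] by simp
qed

text \<open>For core degree \<open>2 * r + 1\<close> and \<open>l\<close> leaves,
  \<open>2 * r + 1 + 2 * l = 2 * k + 1\<close> gives \<open>k - r - l = 0\<close>.\<close>

lemma new_pendants_skeleton:
  assumes "1 \<le> k"
  shows "new_pendants k skeleton = {}"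
proof -
  have False if vi: "(v, i) \<in> new_pendants k skeleton" for v i
  proof -
    obtain r where v: "v \<in> verts (core skeleton)" "out_degree (core skeleton) v = 2 * r + 1"
        "i < k - r - leaf_count skeleton v"
      using vi unfolding new_pendants_def by blast
    obtain a where a: "v = \<iota> a" "a \<in> A \<inter> S" using v(1) core_skeleton(1)[OF assms] by auto
    show False
      using v(2,3) core_degree[OF assms a(2)] leaf_count_skeleton[OF assms a(2)] a(1) degree_sum[OF a(2)]
      by simp
  qed
  then show ?thesis by auto
qed

text \<open>The isomorphism maps each split vertex to the midpoint of the core edge between its ends
  and renames the other vertices. Different split vertices get different midpoints by
  \<open>split_eqI\<close>.\<close>

lemma T_part:
  assumes "1 \<le> k"
  shows "\<exists>H \<in> T_trees k. \<exists>f. inj_on f S \<and> pverts H = f ` S \<and> parcs H = map_prod f f ` arcs_S"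
proof -
  define f where "f x = (if x \<in> split then Mid {\<iota> (g x), \<iota> (h x)} else Old (\<iota> x))" for x
  have f_split: "f b = Mid {\<iota> (g b), \<iota> (h b)}" if "b \<in> split" for b using that by (simp add: f_def)
  have f_other: "f x = Old (\<iota> x)" if "x \<notin> split" for x using that by (simp add: f_def)
  have split_ends: "g b \<in> S \<inter> A" "h b \<in> S \<inter> A" if "b \<in> split" "b \<in> S" for b
    using that S_closed_ends(1,2)[of b] ends_in_A[of b] by (auto simp: split_def)
  have inj: "inj_on f S"
  proof (rule inj_onI)
    fix x y assume xy: "x \<in> S" "y \<in> S" "f x = f y"
    show "x = y"
    proof (cases "x \<in> split")
      case True
      then have y: "y \<in> split" using xy(3) by (simp add: f_def split: if_splits)
      have "\<iota> ` {g x, h x} = \<iota> ` {g y, h y}" using xy(3) True y by (simp add: f_def)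
      then have "{g x, h x} = {g y, h y}"
        using inj_on_image_eq_iff[OF inj_S, of "{g x, h x}" "{g y, h y}"]
          split_ends[OF True xy(1)] split_ends[OF y xy(2)] by simp
      then show ?thesis by (rule split_eqI[OF True y])
    next
      case False
      then have "\<iota> x = \<iota> y" using xy(3) by (simp add: f_def split: if_splits)
      then show ?thesis using \<iota>_eq_iff[OF xy(1,2)] by simp
    qed
  qed
  have link_split: "\<exists>b\<in>split \<inter> S. {x, y} = {g b, h b}" if xy: "(x, y) \<in> links" for x y
  proof -
    obtain b where b: "b \<in> split" "{x, y} = {g b, h b}" using xy by (auto simp: links_def linked_def)
    have "g b \<in> S" using b(2) xy by (auto simp: links_def doubleton_eq_iff)
    then show ?thesis using b S_closed_ends(3)[of b] by (auto simp: split_def)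
  qed
  have split_link: "(g b, h b) \<in> links" "(h b, g b) \<in> links" if "b \<in> split" "b \<in> S" for b
    using split_ends[OF that] that(1) by (auto simp: links_def linked_def insert_commute)
  have mids: "{Mid {u, v} | u v. (u, v) \<in> arcs (core skeleton)} = f ` (S \<inter> split)"
  proof (intro equalityI subsetI)
    fix z assume "z \<in> {Mid {u, v} | u v. (u, v) \<in> arcs (core skeleton)}"
    then obtain x y where "z = Mid (\<iota> ` {x, y})" "(x, y) \<in> links"
      unfolding core_skeleton(2)[OF assms] by auto
    moreover obtain b where "b \<in> split \<inter> S" "{x, y} = {g b, h b}" using link_split calculation(2) by blast
    ultimately have "z = f b" by (simp add: f_split)
    then show "z \<in> f ` (S \<inter> split)" using \<open>b \<in> split \<inter> S\<close> by blast
  next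
    fix z assume "z \<in> f ` (S \<inter> split)"
    then obtain b where b: "b \<in> S" "b \<in> split" "z = Mid {\<iota> (g b), \<iota> (h b)}" by (auto simp: f_split)
    have "(\<iota> (g b), \<iota> (h b)) \<in> arcs (core skeleton)"
      using split_link(1)[OF b(2,1)] unfolding core_skeleton(2)[OF assms] by force
    then show "z \<in> {Mid {u, v} | u v. (u, v) \<in> arcs (core skeleton)}" using b(3) by blast
  qed
  have verts: "pverts (T_of k skeleton) = f ` S"
  proof -
    have "Old ` pverts skeleton = f ` (S - split)"
      unfolding skeleton_simps(1) image_image by (intro image_cong) (auto simp: f_other)
    then have "pverts (T_of k skeleton) = f ` (S - split) \<union> f ` (S \<inter> split)"
      unfolding T_of_simps(1) mids new_pendants_skeleton[OF assms] by simp
    then show ?thesis unfolding image_Un[symmetric] by (simp only: Un_Diff_Int)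
  qed
  let ?whole = "{(Old u, Old v) | u v. (u, v) \<in> parcs skeleton \<and> (u \<in> Leaf skeleton \<or> v \<in> Leaf skeleton)}"
  let ?mid = "{(Old u, Mid {u, v}) | u v. (u, v) \<in> arcs (core skeleton)}"
  \<comment> \<open>\<open>P\<close> and \<open>Q\<close> hold the arcs of the component from
    senders to receivers, \<open>P\<close> at whole and \<open>Q\<close> at split vertices; they
    yield the leaf arcs and the midpoint arcs of \<open>T_of\<close>.\<close>
  define P where "P = {(b, g b) | b. b \<in> whole \<inter> S}"
  define Q where "Q = {(b, g b) | b. b \<in> split \<inter> S} \<union> {(b, h b) | b. b \<in> split \<inter> S}"
  have half: "P \<union> Q = {(b, c). b \<in> S \<inter> (V - A) \<and> c \<in> {g b, h b}}"
    unfolding P_def Q_def split_whole(1) using wholeD(4) by auto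
  have arcs_S_eq: "arcs_S = P \<union> P\<inverse> \<union> Q \<union> Q\<inverse>"
  proof -
    have "arcs_S = (P \<union> Q) \<union> (P \<union> Q)\<inverse>"
    proof (rule set_eqI, clarify)
      fix x y
      have "(x, y) \<in> arcs_S \<longleftrightarrow> x \<in> S \<and> y \<in> S \<and> (x, y) \<in> parcs cover" by (auto simp: arcs_S_def)
      then show "(x, y) \<in> arcs_S \<longleftrightarrow> (x, y) \<in> (P \<union> Q) \<union> (P \<union> Q)\<inverse>"
        unfolding half parcs_cover_iff using S_closed_ends[of x] S_closed_ends[of y] by auto
    qed
    then show ?thesis by blast
  qed
  have f_A: "f x = Old (\<iota> x)" if "x \<in> A" for x using that A_not_split f_other by blast
  have f_P: "map_prod f f e \<in> ?whole \<and> map_prod f f (snd e, fst e) \<in> ?whole" if e: "e \<in> P" for e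
  proof -
    obtain b where b: "e = (b, g b)" "b \<in> whole" "b \<in> S" using e unfolding P_def by blast
    have "(\<iota> b, \<iota> (g b)) \<in> parcs skeleton" using neighbours_whole[of b] b by blast
    moreover from this have "(\<iota> (g b), \<iota> b) \<in> parcs skeleton"
      using pair_sym_digraph.arcs_symmetric pair_graph_skeleton
      by (metis pair_graph.axioms(2) pair_pseudo_graph.axioms(2))
    moreover have "\<iota> b \<in> Leaf skeleton" using b Leaf_skeleton[OF assms] by blast
    ultimately show ?thesis using b f_A f_other wholeD[OF b(2)] by auto
  qed
  have whole_eq: "?whole = map_prod f f ` (P \<union> P\<inverse>)"
  proof (intro equalityI subsetI)
    fix z assume "z \<in> ?whole"
    then obtain u v where uv: "z = (Old u, Old v)" "(u, v) \<in> parcs skeleton"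
        "u \<in> Leaf skeleton \<or> v \<in> Leaf skeleton" by blast
    have vu: "(v, u) \<in> parcs skeleton"
      using uv(2) pair_sym_digraph.arcs_symmetric pair_graph_skeleton
      by (metis pair_graph.axioms(2) pair_pseudo_graph.axioms(2))
    have pend: "\<exists>b\<in>whole \<inter> S. u = \<iota> b \<and> v = \<iota> (g b)"
      if uv: "u \<in> Leaf skeleton" "(u, v) \<in> parcs skeleton" for u v
    proof -
      obtain b where b: "u = \<iota> b" "b \<in> whole \<inter> S" using uv(1) Leaf_skeleton[OF assms] by blast
      then show ?thesis using neighbours_whole[OF b(2)] uv(2) by blast
    qed
    have "Old (\<iota> b) = f b \<and> Old (\<iota> (g b)) = f (g b) \<and> (b, g b) \<in> P" if "b \<in> whole \<inter> S" for b
      using that f_A f_other wholeD[of b] by (auto simp: P_def)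
    then show "z \<in> map_prod f f ` (P \<union> P\<inverse>)"
      using uv(1,3) pend[of u v, OF _ uv(2)] pend[of v u, OF _ vu] by force
  next
    fix z assume "z \<in> map_prod f f ` (P \<union> P\<inverse>)"
    then obtain x y where "z = map_prod f f (x, y)" "(x, y) \<in> P \<or> (y, x) \<in> P" by auto
    then show "z \<in> ?whole" using f_P[of "(x, y)"] f_P[of "(y, x)"] by auto
  qed
  \<comment> \<open>\<open>?mid\<close> runs from a centre to a midpoint, against the direction of
    \<open>Q\<close>.\<close>
  have mid_eq: "?mid = map_prod f f ` Q\<inverse>"
  proof (intro equalityI subsetI)
    fix z assume "z \<in> ?mid"
    then obtain x y where xy: "z = (Old (\<iota> x), Mid (\<iota> ` {x, y}))" "(x, y) \<in> links"
      unfolding core_skeleton(2)[OF assms] by auto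
    then obtain b where b: "b \<in> split \<inter> S" "{x, y} = {g b, h b}" using link_split by blast
    then have "x = g b \<or> x = h b" by blast
    then have "(b, x) \<in> Q" "x \<in> A" using b split_ends[of b] by (auto simp: Q_def)
    moreover have "Mid (\<iota> ` {x, y}) = f b" using b by (simp add: f_split)
    ultimately have "z = map_prod f f (x, b)" using xy(1) f_A by simp
    then show "z \<in> map_prod f f ` Q\<inverse>" using \<open>(b, x) \<in> Q\<close> by blast
  next
    fix z assume "z \<in> map_prod f f ` Q\<inverse>"
    then obtain b c where b: "b \<in> split" "b \<in> S" "c = g b \<or> c = h b" "z = (f c, f b)"
      by (auto simp: Q_def)
    then obtain d where d: "(c, d) \<in> links" "{c, d} = {g b, h b}"
      using split_link[OF b(1,2)] by (metis insert_commute)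
    have "z = (Old (\<iota> c), Mid {\<iota> c, \<iota> d})"
    proof -
      have "\<iota> ` {c, d} = \<iota> ` {g b, h b}" using d(2) by simp
      then show ?thesis using b f_A split_ends[of b] by (auto simp: f_split)
    qed
    moreover have "(\<iota> c, \<iota> d) \<in> arcs (core skeleton)"
      using d(1) unfolding core_skeleton(2)[OF assms] by force
    ultimately show "z \<in> ?mid" by blast
  qed
  have "parcs (T_of k skeleton) = ?whole \<union> ?whole\<inverse> \<union> ?mid \<union> ?mid\<inverse>"
    unfolding T_of_simps(2) new_pendants_skeleton[OF assms] by blast
  also have "\<dots> = map_prod f f ` arcs_S"
    unfolding whole_eq mid_eq arcs_S_eq by auto
  finally have "parcs (T_of k skeleton) = map_prod f f ` arcs_S" .
  moreover have "T_of k skeleton \<in> T_trees k" using admissible_skeleton[OF assms] by (auto simp: T_trees_def)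
  ultimately show ?thesis using inj verts by blast
qed

end


section \<open>Every component of the cover belongs to the family\<close>

lemma (in tight_allotment) component_iso:
  assumes "C \<in> pre_digraph.sccs (with_proj cover)" "1 \<le> k"
  shows "\<exists>H \<in> stars k \<union> T_trees k. digraph_iso C (with_proj H)"
proof -
  interpret F: pair_graph cover by (rule pair_graph_cover)
  note C = F.component_facts[OF assms(1)]
  have wf: "wf_digraph C" using C(1) F.wellformed_induce_subgraph by metis
  have th: "tail C = fst" "head C = snd"
    using arg_cong[OF C(1), of tail] arg_cong[OF C(1), of head] by simp_all
  have arcs_C: "arcs C = {(x, y) \<in> parcs cover. x \<in> verts C \<and> y \<in> verts C}"
    using arg_cong[OF C(1), of arcs] by (simp add: case_prod_beta')
  obtain \<iota> :: "'a \<Rightarrow> nat" where \<iota>: "inj_on \<iota> V"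
    using finite_imp_inj_to_nat_seg[OF finite_V] by blast
  have part: "connected_part k E V A g h (verts C) \<iota>"
  proof
    show "verts C \<subseteq> V" using C(2) by simp
    show "verts C \<noteq> {}" using C(3) by (simp add: strongly_connected_def)
    show "y \<in> verts C" if "(x, y) \<in> parcs cover" "x \<in> verts C" for x y using C(4) that by blast
    show "inj_on \<iota> V" by (rule \<iota>)
    fix T assume T: "T \<subseteq> verts C" "T \<noteq> {}" "\<And>x y. x \<in> T \<Longrightarrow> (x, y) \<in> parcs cover \<Longrightarrow> y \<in> T"
    obtain x where x: "x \<in> T" using T(2) by blast
    have "y \<in> T" if y: "y \<in> verts C" for y
    proof -
      have "x \<rightarrow>\<^sup>*\<^bsub>C\<^esub> y" using C(3) x y T(1) by (auto simp: strongly_connected_def)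
      then show ?thesis
      proof (induction rule: wf_digraph.reachable_induct[OF wf, consumes 1, case_names base step])
        case base
        show ?case by (rule x)
      next
        case (step u v)
        have "(u, v) \<in> arcs C" using step(2) th by (auto simp: arcs_ends_conv)
        then show ?case using T(3)[OF step(3)] arcs_C by blast
      qed
    qed
    then show "T = verts C" using T(1) by blast
  qed
  interpret part: connected_part k E V A g h "verts C" \<iota> by (rule part)
  have "\<exists>H \<in> stars k \<union> T_trees k. \<exists>f. inj_on f (verts C) \<and> pverts H = f ` verts C \<and>
      parcs H = map_prod f f ` part.arcs_S"
  \<comment> \<open>One centre without a split edge makes the whole component a star; otherwise
    every centre has one and the component is some \<open>T_of k R\<close>.\<close>
  proof (cases "\<exists>a\<in>A \<inter> verts C. \<forall>b\<in>split. a \<notin> {g b, h b}")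
    case True
    then obtain a where "a \<in> A \<inter> verts C" "\<And>b. b \<in> split \<Longrightarrow> a \<notin> {g b, h b}" by blast
    then show ?thesis using part.star_part[of a] by blast
  next
    case False
    interpret tree: tree_part k E V A g h "verts C" \<iota>
      using False by unfold_locales blast
    show ?thesis using tree.T_part[OF assms(2)] by blast
  qed
  moreover have "part.arcs_S = arcs C" unfolding part.arcs_S_def arcs_C by blast
  ultimately show ?thesis unfolding digraph_iso_pair_iff[OF wf th] by simp
qed

section \<open>Sufficiency\<close>

text \<open>This is the condition of \<open>two_token_hall\<close> for \<open>G\<close>. The
  vertices \<open>I\<close> isolated within \<open>X\<close> are isolated once their neighbourhood
  is removed, so \<open>bound\<close> applies to them. Every other vertex of \<open>X\<close> has a
  neighbour in \<open>X\<close> and thus lies in the neighbourhood of \<open>X\<close> itself, which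
  pays for it as \<open>2 \<le> 2 * k + 1\<close>.\<close>

lemma double_cover_bound:
  assumes "pair_graph G" "1 \<le> k"
    and bound: "\<And>S. S \<subseteq> pverts G \<Longrightarrow>
      real (iso_count (with_proj G \<restriction> (pverts G - S))) \<le> (real k + 1 / 2) * real (card S)"
    and X: "X \<subseteq> pverts G"
  shows "2 * card X \<le> (2 * k + 1) * card (\<Union>v\<in>X. {u \<in> pverts G. (v, u) \<in> parcs G})"
proof -
  interpret pair_graph G by fact
  let ?N = "\<lambda>X. \<Union>v\<in>X. {u \<in> pverts G. (v, u) \<in> parcs G}"
  define I where "I = {v \<in> X. \<forall>u\<in>X. (v, u) \<notin> parcs G}"
  have fin: "finite X" "finite I" "finite (X - I)" "finite (?N I)" "finite (?N X)"
    using X pair_finite_verts finite_subset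
    by (auto simp: I_def intro: finite_subset[of _ "pverts G"])
  have disj: "?N I \<inter> X = {}" by (auto simp: I_def)
  have sub: "?N I \<union> (X - I) \<subseteq> ?N X"
    using X arcs_symmetric by (auto simp: I_def)
  let ?iso = "{v \<in> pverts G - ?N I. \<forall>u\<in>pverts G - ?N I. (v, u) \<notin> parcs G}"
  have "I \<subseteq> ?iso" using disj X by (auto simp: I_def)
  then have "card I \<le> card ?iso"
    using pair_finite_verts by (intro card_mono) auto
  then have "real (card I) \<le> real (iso_count (with_proj G \<restriction> (pverts G - ?N I)))"
    by (simp add: iso_count_restrict[OF assms(1)])
  also have "\<dots> \<le> (real k + 1 / 2) * real (card (?N I))" by (intro bound) blast
  finally have "real (2 * card I) \<le> real ((2 * k + 1) * card (?N I))" by (simp add: field_simps)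
  then have I: "2 * card I \<le> (2 * k + 1) * card (?N I)" by (simp only: of_nat_le_iff)
  have "2 * card X = 2 * card I + 2 * card (X - I)"
  proof -
    have "I \<subseteq> X" by (auto simp: I_def)
    then show ?thesis using card_mono[of X I] card_Diff_subset[of I X] fin by simp
  qed
  also have "\<dots> \<le> (2 * k + 1) * card (?N I) + (2 * k + 1) * card (X - I)"
    using I \<open>1 \<le> k\<close> by (intro add_mono mult_le_mono1) auto
  also have "\<dots> = (2 * k + 1) * card (?N I \<union> (X - I))"
    using fin disj by (subst card_Un_disjoint) (auto simp: distrib_left)
  also have "\<dots> \<le> (2 * k + 1) * card (?N X)"
    using fin sub by (intro mult_le_mono2 card_mono)
  finally show ?thesis .
qed

lemma isolated_bound_imp_factor:
  assumes "2 \<le> k" "pair_graph G"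
    and bound: "\<And>S. S \<subseteq> pverts G \<Longrightarrow>
      real (iso_count (with_proj G \<restriction> (pverts G - S))) \<le> (real k + 1 / 2) * real (card S)"
  shows "\<exists>F. is_factor (stars k \<union> T_trees k) F G"
proof -
  interpret G: pair_graph G by fact
  have k: "1 \<le> k" using \<open>2 \<le> k\<close> by simp
  define E where "E u v \<longleftrightarrow> (u, v) \<in> parcs G" for u v
  have sym: "E x y \<Longrightarrow> E y x" and irr: "\<not> E x x" for x y
    using G.arcs_symmetric G.no_loops' by (auto simp: E_def)
  have "\<exists>A g h. allotment k E (pverts G) A g h"
    using G.pair_finite_verts sym irr \<open>2 \<le> k\<close> double_cover_bound[OF \<open>pair_graph G\<close> k bound]
    by (intro allotment_exists) (simp_all add: E_def)
  then obtain A g h where tight: "tight_allotment k E (pverts G) A g h"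
    using tight_allotment_exists[of "pverts G" E k] G.pair_finite_verts sym \<open>2 \<le> k\<close> by blast
  interpret tight_allotment k E "pverts G" A g h by (rule tight)
  interpret F: pair_graph cover by (rule pair_graph_cover)
  have "parcs cover \<subseteq> parcs G" using cover_arcs_E[OF sym] by (auto simp: E_def)
  then have "spanning (with_proj cover) (with_proj G)"
    unfolding spanning_def
    by (auto intro!: subgraphI F.wf_digraph_axioms G.wf_digraph_axioms)
  then have "is_factor (stars k \<union> T_trees k) cover G"
    unfolding is_factor_def using pair_graph_cover component_iso k by blast
  then show ?thesis by blast
qed

theorem theorem7:
  fixes G :: "'a pair_pre_digraph" and k :: nat
  assumes "2 \<le> k" and "pair_graph G"
  shows "(\<exists>F. is_factor (stars k \<union> T_trees k) F G) \<longleftrightarrow>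
    (\<forall>S \<subseteq> pverts G.
       real (iso_count (with_proj G \<restriction> (pverts G - S))) \<le> (real k + 1 / 2) * real (card S))"
  using factor_imp_isolated_bound[OF assms] isolated_bound_imp_factor[OF assms] by blast

end
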